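(* Let $G=(V,A)$ be a minimally Eulerian digraph with $|V|=n>1$. Then there exist an ordering $v_1,\dots,v_n$ of $V$ and a decomposition of $A$ into $n$ pairwise arc-disjoint directed paths $P_1,\dots,P_n$ (whose arc sets partition $A$) such that each $P_i$ is a directed path from $v_i$ to $v_{i+1}$ (with $v_{n+1}:=v_1$) of length at most $\lceil f(n)\sqrt{n}\rceil$, where $f$ is a function satisfying $f(n) = (\log_2 n)^{\log_{3/2} 2 + o(1)}$ and $f(n)\le \tfrac{1}{2}\log_2^2 n$. In particular each $P_i$ has length at most $\lceil \tfrac12 \sqrt{n}\,\log_2^2 n\rceil$.
   Context: Digraphs are simple. A connected digraph is Eulerian if every vertex has indegree equal to outdegree. A digraph $G$ is minimally Eulerian if it is a connected Eulerian digraph that contains no proper connected Eulerian spanning subgraph; equivalently, for every directed cycle $C$ of $G$, the digraph $(V, A\setminus A(C))$ is disconnected. The length of a directed path is its number of arcs. $\log_2^2 n$ means $(\log_2 n)^2$. *)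

theory Defs
  imports "HOL-Analysis.Analysis"
begin

text \<open>A simple digraph (V, A): finite vertex set, arcs between vertices, no loops
  (A is a set of ordered pairs, so there are no parallel arcs).\<close>
definition simple_digraph :: "'a set \<Rightarrow> ('a \<times> 'a) set \<Rightarrow> bool" where
  "simple_digraph V A \<longleftrightarrow> finite V \<and> A \<subseteq> V \<times> V \<and> (\<forall>v. (v, v) \<notin> A)"

text \<open>Connected = weakly connected (underlying undirected graph connected).\<close>
definition digraph_connected :: "'a set \<Rightarrow> ('a \<times> 'a) set \<Rightarrow> bool" where
  "digraph_connected V A \<longleftrightarrow> V \<noteq> {} \<and> (\<forall>u\<in>V. \<forall>v\<in>V. (u, v) \<in> (A \<union> A\<inverse>)\<^sup>*)"

definition in_degree :: "('a \<times> 'a) set \<Rightarrow> 'a \<Rightarrow> nat" where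
  "in_degree A v = card {u. (u, v) \<in> A}"

definition out_degree :: "('a \<times> 'a) set \<Rightarrow> 'a \<Rightarrow> nat" where
  "out_degree A v = card {w. (v, w) \<in> A}"

definition eulerian :: "'a set \<Rightarrow> ('a \<times> 'a) set \<Rightarrow> bool" where
  "eulerian V A \<longleftrightarrow> digraph_connected V A \<and> (\<forall>v\<in>V. in_degree A v = out_degree A v)"

text \<open>Minimally Eulerian: a connected Eulerian simple digraph with no proper connected
  Eulerian spanning subgraph.\<close>
definition minimally_eulerian :: "'a set \<Rightarrow> ('a \<times> 'a) set \<Rightarrow> bool" where
  "minimally_eulerian V A \<longleftrightarrow> simple_digraph V A \<and> eulerian V A \<and>
     \<not> (\<exists>A'. A' \<subset> A \<and> eulerian V A')"

text \<open>A directed path given by its vertex sequence: distinct vertices, consecutive vertices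
  joined by arcs of A.  Its arcs and its length (number of arcs).\<close>
definition path_arcs :: "'a list \<Rightarrow> ('a \<times> 'a) set" where
  "path_arcs ps = set (zip ps (tl ps))"

definition path_length :: "'a list \<Rightarrow> nat" where
  "path_length ps = length ps - 1"

definition is_dipath :: "('a \<times> 'a) set \<Rightarrow> 'a list \<Rightarrow> 'a \<Rightarrow> 'a \<Rightarrow> bool" where
  "is_dipath A ps u v \<longleftrightarrow> ps \<noteq> [] \<and> hd ps = u \<and> last ps = v \<and> distinct ps \<and>
     path_arcs ps \<subseteq> A"

end

theory Submission
  imports "HOL-Real_Asymp.Real_Asymp" "Graph_Theory.Euler" Defs
begin

text \<open>
  Fix an Eulerian tour and mark one visit of each vertex.  By minimality every piece of the tour
  between consecutive marks is automatically a path: a closed subwalk inside a piece could be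
  deleted without losing a vertex.  So it suffices to place the marks with small gaps, and for
  this Hall's theorem has to provide distinct representatives for disjoint tour intervals of
  length about \<open>9 \<surd>n\<close>.

  If Hall's condition failed, some set \<open>U\<close> of \<open>u\<close> vertices would contain \<open>u + 1\<close> such intervals,
  hence span a set \<open>H\<close> of more than \<open>9 u \<surd>n\<close> arcs.  By minimality, deleting disjoint cycles of \<open>H\<close>
  one by one increases the number of components meeting \<open>U\<close> each time, so there are fewer
  than \<open>u\<close> of them.  A maximal packing of cycles of length at most \<open>2 R\<close>, where \<open>R \<approx> \<surd>n\<close>, thus
  uses at most \<open>2 R u\<close> arcs.  The remaining arcs have no short cycles, so, by growing balls and
  cutting at a sparse layer, \<open>U\<close> can be ordered with at most \<open>2 u\<^sup>2 / R\<^sup>2\<close> backward arcs.  The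
  \<open>u + 1\<close> walks have total displacement less than \<open>(u + 1) u\<close> in this order, so most arcs are
  short, and there are too few pairs of vertices at short distance.

  This bounds the lengths by \<open>O(\<surd>n)\<close>; the logarithmic factor only has to absorb constants.
\<close>

subsection \<open>Balanced arc sets and components\<close>

text \<open>Degrees are compared at every vertex of the type and connectedness is left out, so the
  notion fits a piece of the tour or a cycle of a packing without naming a vertex set.\<close>

definition balanced :: "('a \<times> 'a) set \<Rightarrow> bool" where
  "balanced C \<longleftrightarrow> (\<forall>v. in_degree C v = out_degree C v)"

lemma degree_Diff:
  assumes "finite A" and "C \<subseteq> A"
  shows "in_degree (A - C) v = in_degree A v - in_degree C v"
    and "out_degree (A - C) v = out_degree A v - out_degree C v"
proof -
  have "{u. (u, v) \<in> C} \<subseteq> fst ` A" "{u. (v, u) \<in> C} \<subseteq> snd ` A"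
    using assms(2) by force+
  then have f: "finite {u. (u, v) \<in> C}" "finite {u. (v, u) \<in> C}"
    using assms(1) by (meson finite_imageI finite_subset)+
  have "{u. (u, v) \<in> A - C} = {u. (u, v) \<in> A} - {u. (u, v) \<in> C}"
    "{u. (v, u) \<in> A - C} = {u. (v, u) \<in> A} - {u. (v, u) \<in> C}" by auto
  then show "in_degree (A - C) v = in_degree A v - in_degree C v"
    "out_degree (A - C) v = out_degree A v - out_degree C v"
    unfolding in_degree_def out_degree_def using f assms(2)
    by (auto intro!: card_Diff_subset)
qed

text \<open>By injectivity, arcs into \<open>v\<close> correspond to positions whose successor
  visits \<open>v\<close>, and arcs out of \<open>v\<close> to positions that visit
  \<open>v\<close>. The two counts differ by an index shift, and the end terms cancel because the
  trail is closed.\<close>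

lemma balanced_closed_trail:
  assumes inj: "inj_on (\<lambda>p. (w p, w (Suc p))) {a..<b}" and "a \<le> b" and closed: "w a = w b"
  shows "balanced ((\<lambda>p. (w p, w (Suc p))) ` {a..<b})" (is "balanced ?C")
  unfolding balanced_def
proof
  fix v
  have "in_degree ?C v = card (w ` {p\<in>{a..<b}. w (Suc p) = v})"
    unfolding in_degree_def by (rule arg_cong[where f = card]) auto
  also have "\<dots> = card {p\<in>{a..<b}. w (Suc p) = v}"
    by (rule card_image) (use inj in \<open>auto simp: inj_on_def\<close>)
  also have "\<dots> = (\<Sum>p = a..<b. if w (Suc p) = v then 1 else 0)"
    by (simp add: sum.If_cases Int_def)
  also have "\<dots> = (\<Sum>p = a..<b. if w p = v then 1 else 0)"
  proof -
    have "(\<Sum>p = a..<b. if w (Suc p) = v then 1 else 0) + (if w a = v then 1 else 0)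
        = (\<Sum>p = a..<b. if w p = v then 1 else 0) + (if w b = v then 1 else (0::nat))"
      using \<open>a \<le> b\<close> by (induction rule: dec_induct) auto
    then show ?thesis using closed by simp
  qed
  also have "\<dots> = card {p\<in>{a..<b}. w p = v}"
    by (simp add: sum.If_cases Int_def)
  also have "\<dots> = card ((\<lambda>p. w (Suc p)) ` {p\<in>{a..<b}. w p = v})"
    by (rule card_image[symmetric]) (use inj in \<open>auto simp: inj_on_def\<close>)
  also have "\<dots> = out_degree ?C v"
    unfolding out_degree_def by (rule arg_cong[where f = card]) auto
  finally show "in_degree ?C v = out_degree ?C v" .
qed

text \<open>Each vertex \<open>v\<close> enters with \<open>\<phi> v\<close> times indegree minus
  outdegree. With \<open>\<phi>\<close> an ordering of the vertices, removing disjoint cycles thus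
  leaves the total displacement of an arc set unchanged.\<close>

lemma balanced_sum_eq_0:
  fixes \<phi> :: "'a \<Rightarrow> int"
  assumes "finite C" and "balanced C"
  shows "(\<Sum>(x, y)\<in>C. \<phi> y - \<phi> x) = 0"
proof -
  let ?F = "fst ` C \<union> snd ` C"
  have fin: "finite ?F" using assms(1) by simp
  have "(\<Sum>e\<in>C. \<phi> (snd e)) = (\<Sum>v\<in>?F. \<Sum>e\<in>{e\<in>C. snd e = v}. \<phi> (snd e))"
    by (rule sum.group[symmetric]) (use assms(1) fin in auto)
  also have "\<dots> = (\<Sum>v\<in>?F. int (in_degree C v) * \<phi> v)"
  proof (rule sum.cong[OF refl])
    fix v
    have "{e\<in>C. snd e = v} = (\<lambda>u. (u, v)) ` {u. (u, v) \<in> C}" by force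
    then have "card {e\<in>C. snd e = v} = in_degree C v"
      by (simp add: in_degree_def card_image inj_on_def)
    then show "(\<Sum>e\<in>{e\<in>C. snd e = v}. \<phi> (snd e)) = int (in_degree C v) * \<phi> v" by simp
  qed
  also have "\<dots> = (\<Sum>v\<in>?F. int (out_degree C v) * \<phi> v)"
    using assms(2) by (simp add: balanced_def)
  also have "\<dots> = (\<Sum>v\<in>?F. \<Sum>e\<in>{e\<in>C. fst e = v}. \<phi> (fst e))"
  proof (rule sum.cong[OF refl])
    fix v
    have "{e\<in>C. fst e = v} = (\<lambda>u. (v, u)) ` {u. (v, u) \<in> C}" by force
    then have "card {e\<in>C. fst e = v} = out_degree C v"
      by (simp add: out_degree_def card_image inj_on_def)
    then show "int (out_degree C v) * \<phi> v = (\<Sum>e\<in>{e\<in>C. fst e = v}. \<phi> (fst e))" by simp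
  qed
  also have "\<dots> = (\<Sum>e\<in>C. \<phi> (fst e))"
    by (rule sum.group) (use assms(1) fin in auto)
  finally show ?thesis by (simp add: case_prod_unfold sum_subtractf)
qed

section \<open>Components of the underlying undirected graph\<close>

definition linked :: "('a \<times> 'a) set \<Rightarrow> ('a \<times> 'a) set" where
  "linked E = (E \<union> E\<inverse>)\<^sup>*"

lemma linked_refl [simp]: "(x, x) \<in> linked E" by (simp add: linked_def)

lemma linked_sym: "(x, y) \<in> linked E \<Longrightarrow> (y, x) \<in> linked E"
  unfolding linked_def by (meson symD sym_Un_converse sym_rtrancl)

lemma linked_trans: "(x, y) \<in> linked E \<Longrightarrow> (y, z) \<in> linked E \<Longrightarrow> (x, z) \<in> linked E"
  unfolding linked_def by (rule rtrancl_trans)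

lemma linked_least:
  assumes "E \<subseteq> linked E'"
  shows "linked E \<subseteq> linked E'"
proof -
  have "E \<union> E\<inverse> \<subseteq> linked E'" using assms by (auto intro: linked_sym)
  then have "linked E \<subseteq> (linked E')\<^sup>*" unfolding linked_def[of E] by (rule rtrancl_mono)
  then show ?thesis by (simp add: linked_def)
qed

lemma subset_linked: "E \<subseteq> linked E" unfolding linked_def by auto

lemma linked_mono: "E \<subseteq> E' \<Longrightarrow> linked E \<subseteq> linked E'"
  using linked_least subset_linked by blast

text \<open>The classes are not cut down to \<open>U\<close>: the cardinality counts the components
  of \<open>E\<close> that meet \<open>U\<close>, and two vertices of \<open>U\<close> may be linked
  through vertices outside.\<close>

definition components :: "'a set \<Rightarrow> ('a \<times> 'a) set \<Rightarrow> 'a set set" where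
  "components U E = (\<lambda>x. linked E `` {x}) ` U"

text \<open>Saturating under \<open>linked E'\<close> maps the classes of \<open>E\<close> onto
  those of \<open>E'\<close>, and it sends the distinct classes of \<open>x\<close> and
  \<open>y\<close> to the same one.\<close>

lemma card_components_less:
  assumes "finite U" and "E \<subseteq> E'" and "x \<in> U" "y \<in> U"
    and "(x, y) \<in> linked E'" "(x, y) \<notin> linked E"
  shows "card (components U E') < card (components U E)"
proof -
  let ?h = "\<lambda>X. linked E' `` X"
  have cls: "?h (linked E `` {z}) = linked E' `` {z}" for z
    using linked_mono[OF assms(2)] linked_trans[of _ _ E'] by auto
  have "components U E' = ?h ` components U E"
    by (simp add: components_def image_image cls)
  moreover have "\<not> inj_on ?h (components U E)"
  proof
    assume inj: "inj_on ?h (components U E)"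
    have "linked E' `` {x} = linked E' `` {y}"
      using assms(5) by (auto intro: linked_trans linked_sym)
    moreover have "linked E `` {x} \<in> components U E" "linked E `` {y} \<in> components U E"
      using assms(3,4) by (simp_all add: components_def)
    ultimately have "linked E `` {x} = linked E `` {y}"
      using inj_onD[OF inj, of "linked E `` {x}" "linked E `` {y}"] by (simp only: cls)
    moreover have "y \<in> linked E `` {y}" by simp
    ultimately have "y \<in> linked E `` {x}" by (simp only:)
    then show False using assms(6) by simp
  qed
  moreover have "finite (components U E)" using assms(1) by (simp add: components_def)
  ultimately show ?thesis
    using card_image_le[of "components U E" ?h] eq_card_imp_inj_on[of "components U E" ?h]
    by (metis nat_less_le)
qed

text \<open>Otherwise \<open>A - C\<close> would still be connected, and since degrees subtract it
  would be a proper Eulerian spanning subgraph.\<close>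

lemma minimally_eulerian_Diff:
  assumes "minimally_eulerian V A" and "C \<subseteq> A" and "C \<noteq> {}" and "balanced C"
  shows "\<not> C \<subseteq> linked (A - C)"
proof
  assume "C \<subseteq> linked (A - C)"
  then have "C \<union> (A - C) \<subseteq> linked (A - C)" by (rule Un_least) (rule subset_linked)
  moreover have "C \<union> (A - C) = A" using assms(2) by blast
  ultimately have "A \<subseteq> linked (A - C)" by simp
  then have "linked A \<subseteq> linked (A - C)" by (rule linked_least)
  moreover have A: "finite V" "A \<subseteq> V \<times> V" "eulerian V A"
    using assms(1) by (auto simp: minimally_eulerian_def simple_digraph_def)
  moreover have "V \<noteq> {}" "\<forall>u\<in>V. \<forall>v\<in>V. (u, v) \<in> linked A"
    using A(3) by (simp_all add: eulerian_def digraph_connected_def linked_def)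
  ultimately have "V \<noteq> {}" "\<forall>u\<in>V. \<forall>v\<in>V. (u, v) \<in> linked (A - C)" by blast+
  then have "digraph_connected V (A - C)"
    by (simp add: digraph_connected_def linked_def)
  moreover have "finite A" using A finite_subset by blast
  then have "\<forall>v\<in>V. in_degree (A - C) v = out_degree (A - C) v"
    using A(3) assms(2,4) by (simp add: degree_Diff eulerian_def balanced_def)
  ultimately have "eulerian V (A - C)" by (simp add: eulerian_def)
  then show False using assms unfolding minimally_eulerian_def by blast
qed

text \<open>Deleting the members one at a time raises the number of components meeting
  \<open>U\<close> each time, from at least one to at most \<open>card U\<close>.\<close>

lemma card_packing_less:
  assumes min: "minimally_eulerian V A" and "finite U" "U \<noteq> {}" and "finite \<C>"
    and \<C>: "\<And>C. C \<in> \<C> \<Longrightarrow> C \<subseteq> A \<inter> U \<times> U \<and> C \<noteq> {} \<and> balanced C"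
    and disj: "pairwise disjnt \<C>"
  shows "card \<C> < card U"
proof -
  have "card \<C> < card (components U (A - \<Union>\<C>))"
    using \<open>finite \<C>\<close> \<C> disj
  proof (induction \<C>)
    case empty
    show ?case using assms(2,3) by (simp add: components_def card_gt_0_iff)
  next
    case (insert C \<D>)
    let ?E = "A - \<Union>(insert C \<D>)"
    have C: "C \<subseteq> A" "C \<subseteq> U \<times> U" "C \<noteq> {}" "balanced C" using insert.prems(1)[of C] by auto
    \<comment> \<open>Minimality of \<open>A\<close> itself suffices at every stage: vertices
      separated by deleting \<open>C\<close> alone stay separated when more arcs are
      deleted.\<close>
    have "?E \<subseteq> A - C" by auto
    then have "\<not> C \<subseteq> linked ?E"
      using minimally_eulerian_Diff[OF min C(1,3,4)] linked_mono by blast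
    then obtain x y where xy: "(x, y) \<in> C" "(x, y) \<notin> linked ?E" by auto
    have "C \<inter> \<Union>\<D> = {}"
      using insert.hyps(2) insert.prems(2) by (auto simp: pairwise_insert disjnt_def)
    then have "(x, y) \<in> linked (A - \<Union>\<D>)" using subset_linked[of "A - \<Union>\<D>"] xy(1) C(1) by blast
    then have "card (components U (A - \<Union>\<D>)) < card (components U ?E)"
      using card_components_less[of U ?E "A - \<Union>\<D>" x y] xy C(2) assms(2) by blast
    moreover have "card \<D> < card (components U (A - \<Union>\<D>))"
      using insert by (auto simp: pairwise_insert)
    ultimately show ?case using insert.hyps by simp
  qed
  also have "\<dots> \<le> card U" using \<open>finite U\<close> unfolding components_def by (rule card_image_le)
  finally show ?thesis .
qed

subsection \<open>Orderings of digraphs without short cycles\<close>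

text \<open>By \<open>4 * (x * y) \<le> (x + y)\<^sup>2\<close>, a large product of two consecutive
  increments forces a large sum. Hence the induction moves in steps of two, matching (j + 2)^2 - j^2
  = 4 (j + 1).\<close>

lemma quadratic_growth:
  fixes b :: "nat \<Rightarrow> real"
  assumes "b 0 = 0" "b 1 = 1" and "K \<ge> 0"
    and step: "\<And>i. i < R \<Longrightarrow> (b (Suc i) - b i) * (b (Suc (Suc i)) - b (Suc i)) > K * b (Suc i)"
    and mono: "\<And>i. b i \<le> b (Suc i)"
  shows "i \<le> R \<Longrightarrow> b (Suc i) \<ge> 1 + K * (real i)\<^sup>2 / 4"
proof (induction i rule: less_induct)
  case (less i)
  consider "i = 0" | "i = 1" | j where "i = Suc (Suc j)"
    by (metis One_nat_def old.nat.exhaust)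
  then show ?case
  proof cases
    case 1
    then show ?thesis using assms(2) by simp
  next
    case 2
    then have "b 2 - 1 > K" using step[of 0] less.prems assms(1,2) by (simp add: numeral_2_eq_2)
    then show ?thesis using 2 \<open>K \<ge> 0\<close> by (simp add: numeral_2_eq_2)
  next
    case 3
    define x y where "x = b (Suc (Suc j)) - b (Suc j)" and "y = b (Suc (Suc (Suc j))) - b (Suc (Suc j))"
    have pos: "x \<ge> 0" "y \<ge> 0" using mono by (auto simp: x_def y_def)
    have ih1: "b (Suc j) \<ge> 1 + K * (real j)\<^sup>2 / 4" using less 3 by auto
    have "b (Suc (Suc j)) \<ge> K * (real (Suc j))\<^sup>2 / 4" using less.IH[of "Suc j"] less.prems 3 by auto
    then have "K * b (Suc (Suc j)) \<ge> K * (K * (real (Suc j))\<^sup>2 / 4)"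
      using \<open>K \<ge> 0\<close> by (rule mult_left_mono)
    then have "(K * real (Suc j))\<^sup>2 \<le> 4 * (x * y)"
      using step[of "Suc j"] less.prems 3 by (simp add: x_def y_def power2_eq_square algebra_simps)
    also have "\<dots> \<le> (x + y)\<^sup>2"
      using zero_le_power2[of "x - y"] by (simp add: power2_eq_square algebra_simps)
    finally have "K * real (Suc j) \<le> x + y"
      by (rule power2_le_imp_le) (use pos in simp)
    with ih1 have "b (Suc i) \<ge> 1 + K * (real j)\<^sup>2 / 4 + K * real (Suc j)"
      using 3 by (simp add: x_def y_def)
    also have "1 + K * (real j)\<^sup>2 / 4 + K * real (Suc j) = 1 + K * (real i)\<^sup>2 / 4"
      using 3 by (simp add: power2_eq_square field_simps)
    finally show ?thesis by simp
  qed
qed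

text \<open>The radius is shifted by one: the ball of index 0 is empty and that of index 1 is \<open>{v}\<close>.\<close>
primrec ball_out :: "('a \<times> 'a) set \<Rightarrow> 'a \<Rightarrow> nat \<Rightarrow> 'a set" where
  "ball_out H v 0 = {}"
| "ball_out H v (Suc i) = insert v (ball_out H v i \<union> H `` ball_out H v i)"

lemma ball_out_mono: "ball_out H v i \<subseteq> ball_out H v (Suc i)"
  by auto

lemma ball_out_subset: "v \<in> S \<Longrightarrow> H \<subseteq> S \<times> S \<Longrightarrow> ball_out H v i \<subseteq> S"
  by (induction i) auto

lemma ball_out_relpow: "x \<in> ball_out H v (Suc i) \<Longrightarrow> \<exists>j\<le>i. (v, x) \<in> H ^^ j"
proof (induction i arbitrary: x)
  case (Suc i)
  then consider "x = v" | "x \<in> ball_out H v (Suc i)" | z where "z \<in> ball_out H v (Suc i)" "(z, x) \<in> H"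
    by (auto simp del: ball_out.simps simp: ball_out.simps(2)[of H v "Suc i"])
  then show ?case
  proof cases
    case 1
    then show ?thesis by (intro exI[of _ 0]) auto
  next
    case 2
    then show ?thesis using Suc.IH le_Suc_eq by blast
  next
    case 3
    then obtain j where "j \<le> i" "(v, z) \<in> H ^^ j" using Suc.IH by blast
    then have "(v, x) \<in> H ^^ Suc j" using 3(2) by auto
    then show ?thesis using \<open>j \<le> i\<close> by (meson Suc_le_mono)
  qed
qed auto

text \<open>If all products of consecutive layer sizes were large, the ball would outgrow half of
  \<open>S\<close> by \<open>quadratic_growth\<close>. So some ball \<open>X\<close> has few arcs
  leaving it, in proportion to its own size.\<close>

lemma sparse_out_cut:
  assumes "finite S" and "v \<in> S" and "H \<subseteq> S \<times> S" and "card S \<ge> 2" and "R > 0"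
    and small: "2 * card (ball_out H v (Suc R)) \<le> card S + 1"
  shows "\<exists>X. X \<noteq> {} \<and> X \<subset> S \<and> R\<^sup>2 * card (H \<inter> X \<times> (S - X)) \<le> 4 * card X * card (S - X)"
proof -
  define n where "n = card S"
  define B where "B = ball_out H v"
  define b where "b i = real (card (B i))" for i
  \<comment> \<open>Chosen so that \<open>K * R\<^sup>2 / 4\<close> is half of \<open>n\<close>; the
    extra 1 in \<open>quadratic_growth\<close> then contradicts \<open>small\<close>.\<close>
  define K where "K = 2 * real n / (real R)\<^sup>2"
  have Bsub: "B i \<subseteq> S" for i using ball_out_subset[OF assms(2,3)] by (simp add: B_def)
  then have Bfin: "finite (B i)" for i using assms(1) finite_subset by blast
  have Bmono: "B i \<subseteq> B (Suc i)" for i unfolding B_def by (rule ball_out_mono)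
  have "mono B" using Bmono by (rule incseq_SucI)
  have bd: "real (card (B (Suc i) - B i)) = b (Suc i) - b i" for i
    using Bmono Bfin by (simp add: b_def card_Diff_subset card_mono of_nat_diff)
  have "\<exists>i<R. (b (Suc i) - b i) * (b (Suc (Suc i)) - b (Suc i)) \<le> K * b (Suc i)"
  proof (rule ccontr)
    assume *: "\<not> ?thesis"
    have "b (Suc R) \<ge> 1 + K * (real R)\<^sup>2 / 4"
    proof (rule quadratic_growth[where R = R])
      show "b 0 = 0" "b 1 = 1" by (auto simp: b_def B_def)
      show "K \<ge> 0" by (simp add: K_def)
      show "b i \<le> b (Suc i)" for i using Bmono Bfin by (simp add: b_def card_mono)
    qed (use * in \<open>simp_all add: not_le\<close>)
    moreover have "K * (real R)\<^sup>2 = 2 * n" using \<open>R > 0\<close> by (simp add: K_def)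
    ultimately have "2 * card (B (Suc R)) \<ge> 2 + n" by (simp add: b_def field_simps)
    then show False using small by (simp add: B_def n_def)
  qed
  then obtain i where i: "i < R" "(b (Suc i) - b i) * (b (Suc (Suc i)) - b (Suc i)) \<le> K * b (Suc i)"
    by blast
  define X where "X = B (Suc i)"
  let ?cut = "H \<inter> X \<times> (S - X)"
  \<comment> \<open>Arcs starting in \<open>B i\<close> end in \<open>B (Suc i)\<close>, which is
    \<open>X\<close>. So an arc leaving \<open>X\<close> starts in its last layer and ends in the
    next one.\<close>
  have sub: "?cut \<subseteq> (B (Suc i) - B i) \<times> (B (Suc (Suc i)) - B (Suc i))"
    unfolding X_def B_def ball_out.simps(2)[of H v "Suc i"] ball_out.simps(2)[of H v i] by blast
  have "v \<in> X" by (simp add: X_def B_def)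
  have "card (B (Suc (Suc i))) \<le> card (B (Suc R))"
    using i(1) Bfin monoD[OF \<open>mono B\<close>, of "Suc (Suc i)" "Suc R"] by (intro card_mono) auto
  then have le: "2 * card (B (Suc (Suc i))) \<le> n + 1" using small by (simp add: B_def n_def)
  have XB: "card X \<le> card (B (Suc (Suc i)))" unfolding X_def using Bfin Bmono by (intro card_mono) auto
  have XS: "X \<subseteq> S" using Bsub by (simp add: X_def)
  have cardSX: "card (S - X) = n - card X"
    using XS assms(1) by (simp add: n_def card_Diff_subset finite_subset)
  have "X \<noteq> S" using le XB assms(4) by (auto simp: n_def)
  have "R\<^sup>2 * card ?cut \<le> 4 * card X * card (S - X)"
  proof (cases "?cut = {}")
    case True
    then show ?thesis by (simp only: card.empty mult_0_right le0)
  next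
    case False
    \<comment> \<open>A nonempty cut makes \<open>X\<close> strictly smaller than the next ball.
      This absorbs the \<open>+ 1\<close> in \<open>small\<close>, so that \<open>S - X\<close> has
      at least \<open>n / 2\<close> elements.\<close>
    then have "B (Suc (Suc i)) - B (Suc i) \<noteq> {}" using sub by auto
    then have "X \<subset> B (Suc (Suc i))" unfolding X_def using Bmono by blast
    then have "card X < card (B (Suc (Suc i)))" using Bfin by (rule psubset_card_mono[rotated])
    then have n2: "n \<le> 2 * card (S - X)" using le cardSX by linarith
    have "card ?cut \<le> card ((B (Suc i) - B i) \<times> (B (Suc (Suc i)) - B (Suc i)))"
      by (rule card_mono[OF _ sub]) (intro finite_SigmaI finite_Diff Bfin)
    then have "real (card ?cut) \<le> real (card (B (Suc i) - B i) * card (B (Suc (Suc i)) - B (Suc i)))"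
      by (simp only: card_cartesian_product of_nat_le_iff)
    also have "\<dots> \<le> K * card X" using i(2) by (simp add: bd X_def b_def)
    finally have "(real R)\<^sup>2 * real (card ?cut) \<le> 2 * n * card X"
      using \<open>R > 0\<close> by (simp add: K_def field_simps)
    then have "R\<^sup>2 * card ?cut \<le> 2 * n * card X"
      by (simp flip: of_nat_le_iff[where ?'a = real])
    also have "\<dots> \<le> 2 * (2 * card (S - X)) * card X" using n2 by simp
    finally show ?thesis by (simp add: algebra_simps)
  qed
  then show ?thesis using \<open>X \<noteq> S\<close> XS \<open>v \<in> X\<close> by blast
qed

lemma relpow_converseD:
  fixes H :: "('a \<times> 'a) set"
  shows "(x, y) \<in> H\<inverse> ^^ k \<Longrightarrow> (y, x) \<in> H ^^ k"
proof (induction k arbitrary: y)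
  case (Suc k)
  then obtain z where "(z, x) \<in> H ^^ k" "(y, z) \<in> H" by auto
  then show ?case by (rule relpow_Suc_I2[rotated])
qed simp

text \<open>The out-ball and the in-ball of radius \<open>R\<close> around \<open>v\<close> share
  only \<open>v\<close>, since another common vertex would lie on a closed walk of length at most
  \<open>2 * R\<close>. Hence one of them covers at most about half of \<open>S\<close>.\<close>

lemma sparse_cut:
  assumes "finite S" and "H \<subseteq> S \<times> S" and "card S \<ge> 2" and "R > 0"
    and girth: "\<And>j x. 0 < j \<Longrightarrow> j \<le> 2 * R \<Longrightarrow> (x, x) \<notin> H ^^ j"
  shows "\<exists>X. X \<noteq> {} \<and> X \<subset> S \<and> R\<^sup>2 * card (H \<inter> X \<times> (S - X)) \<le> 4 * card X * card (S - X)"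
proof -
  have "S \<noteq> {}" using assms(3) by (intro notI) simp
  then obtain v where v: "v \<in> S" by blast
  have H': "H\<inverse> \<subseteq> S \<times> S" using assms(2) by auto
  let ?B = "ball_out H v (Suc R)" and ?C = "ball_out (H\<inverse>) v (Suc R)"
  have sub: "?B \<subseteq> S" "?C \<subseteq> S" by (rule ball_out_subset[OF v], fact)+
  have "?B \<inter> ?C \<subseteq> {v}"
  proof
    fix x assume x: "x \<in> ?B \<inter> ?C"
    obtain j where j: "j \<le> R" "(v, x) \<in> H ^^ j" using ball_out_relpow[OF IntD1[OF x]] by blast
    obtain k where k: "k \<le> R" "(v, x) \<in> H\<inverse> ^^ k" using ball_out_relpow[OF IntD2[OF x]] by blast
    from k(2) have "(x, v) \<in> H ^^ k" by (rule relpow_converseD)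
    with j(2) have "(v, v) \<in> H ^^ (j + k)" unfolding relpow_add by (rule relcompI)
    then have "j + k = 0" using girth[of "j + k" v] j(1) k(1) by fastforce
    then show "x \<in> {v}" using j(2) by simp
  qed
  then have "card (?B \<inter> ?C) \<le> card {v}" by (rule card_mono[rotated]) simp
  then have "card (?B \<inter> ?C) \<le> 1" by simp
  moreover have "card (?B \<union> ?C) \<le> card S" using sub assms(1) by (intro card_mono) auto
  moreover have "card ?B + card ?C = card (?B \<union> ?C) + card (?B \<inter> ?C)"
    by (rule card_Un_Int[OF finite_subset[OF sub(1) assms(1)] finite_subset[OF sub(2) assms(1)]])
  ultimately consider "2 * card ?B \<le> card S + 1" | "2 * card ?C \<le> card S + 1" by linarith
  then show ?thesis
  proof cases
    case 1
    then show ?thesis using sparse_out_cut[OF assms(1) v assms(2-4)] by blast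
  next
    case 2
    then obtain X where X: "X \<noteq> {}" "X \<subset> S"
      "R\<^sup>2 * card (H\<inverse> \<inter> X \<times> (S - X)) \<le> 4 * card X * card (S - X)"
      using sparse_out_cut[OF assms(1) v H' assms(3,4)] by blast
    \<comment> \<open>The set found for the converse digraph is replaced by its complement, which
      turns the cut around.\<close>
    have "S - (S - X) = X" using X(2) by auto
    moreover have "H\<inverse> \<inter> X \<times> (S - X) = (H \<inter> (S - X) \<times> X)\<inverse>" by auto
    then have "card (H\<inverse> \<inter> X \<times> (S - X)) = card (H \<inter> (S - X) \<times> X)" by simp
    ultimately show ?thesis
      using X by (intro exI[of _ "S - X"]) (auto simp: ac_simps)
  qed
qed

lemma relpow_mono:
  fixes E H :: "('a \<times> 'a) set"
  assumes "E \<subseteq> H" and "(x, y) \<in> E ^^ k"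
  shows "(x, y) \<in> H ^^ k"
  using assms unfolding relpow_fun_conv by blast

text \<open>Split \<open>S\<close> along a sparse cut and order both sides recursively, with
  \<open>Y = S - X\<close> placed before \<open>X\<close>. Only the arcs from \<open>X\<close> to
  \<open>Y\<close> become new backward arcs, and 2 x^2 + 2 y^2 + 4 x y = 2 (x + y)^2 closes the
  induction.\<close>

lemma almost_acyclic_ordering:
  assumes "finite S" and "R > 0"
    and girth: "\<And>j x. 0 < j \<Longrightarrow> j \<le> 2 * R \<Longrightarrow> (x, x) \<notin> H ^^ j"
  shows "\<exists>\<pi>. bij_betw \<pi> S {..<card S} \<and>
    R\<^sup>2 * card {(x, y) \<in> H \<inter> S \<times> S. \<pi> y \<le> \<pi> x} \<le> 2 * (card S)\<^sup>2"
  using assms(1)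
proof (induction "card S" arbitrary: S rule: less_induct)
  case less
  show ?case
  proof (cases "card S \<ge> 2")
    case False
    have "{(x, y) \<in> H \<inter> S \<times> S. \<pi> y \<le> \<pi> x} = {}" for \<pi> :: "'a \<Rightarrow> nat"
    proof -
      have "x = y" if "x \<in> S" "y \<in> S" for x y
        using False that card_le_Suc0_iff_eq[OF less.prems] by auto
      moreover have "(x, x) \<notin> H" for x using girth[of 1 x] \<open>R > 0\<close> by simp
      ultimately show ?thesis by auto
    qed
    moreover obtain \<pi> where "bij_betw \<pi> S {..<card S}"
      using ex_bij_betw_finite_nat[OF less.prems] by (auto simp: atLeast0LessThan)
    ultimately show ?thesis by (metis card.empty le0 mult_0_right)
  next
    case True
    let ?H = "H \<inter> S \<times> S"
    have "(x, x) \<notin> ?H ^^ j" if "0 < j" "j \<le> 2 * R" for j x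
      using girth[OF that, of x] relpow_mono[of ?H H] by blast
    then obtain X where X: "X \<noteq> {}" "X \<subset> S"
      "R\<^sup>2 * card (?H \<inter> X \<times> (S - X)) \<le> 4 * card X * card (S - X)"
      using sparse_cut[OF less.prems _ True \<open>R > 0\<close>, of ?H] by auto
    define Y where "Y = S - X"
    have fin: "finite X" "finite Y" using X(2) less.prems finite_subset by (auto simp: Y_def)
    have cardS: "card S = card X + card Y"
      using fin X(2) less.prems card_mono[of S X] by (auto simp: Y_def card_Diff_subset)
    have "card X < card S" "card Y < card S"
      using cardS X fin by (auto simp: Y_def card_gt_0_iff)
    with less.hyps fin obtain \<pi> \<rho>
      where \<pi>: "bij_betw \<pi> X {..<card X}" "R\<^sup>2 * card {(x, y) \<in> H \<inter> X \<times> X. \<pi> y \<le> \<pi> x} \<le> 2 * (card X)\<^sup>2"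
        and \<rho>: "bij_betw \<rho> Y {..<card Y}" "R\<^sup>2 * card {(x, y) \<in> H \<inter> Y \<times> Y. \<rho> y \<le> \<rho> x} \<le> 2 * (card Y)\<^sup>2"
      by meson
    define \<sigma> where "\<sigma> x = (if x \<in> Y then \<rho> x else card Y + \<pi> x)" for x
    have "bij_betw \<sigma> Y {..<card Y}"
      using \<rho>(1) by (rule bij_betw_cong[THEN iffD1, rotated]) (auto simp: \<sigma>_def)
    moreover have "bij_betw ((+) (card Y)) {..<card X} {card Y..<card S}"
      by (rule bij_betw_byWitness[where f' = "\<lambda>k. k - card Y"]) (auto simp: cardS)
    then have "bij_betw ((+) (card Y) \<circ> \<pi>) X {card Y..<card S}"
      using \<pi>(1) by (rule bij_betw_trans[rotated])
    then have "bij_betw \<sigma> X {card Y..<card S}"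
      by (rule bij_betw_cong[THEN iffD1, rotated]) (auto simp: \<sigma>_def Y_def)
    ultimately have "bij_betw \<sigma> (Y \<union> X) ({..<card Y} \<union> {card Y..<card S})"
      by (rule bij_betw_combine) auto
    moreover have "Y \<union> X = S" "{..<card Y} \<union> {card Y..<card S} = {..<card S}"
      using X(2) cardS by (auto simp: Y_def)
    ultimately have bij: "bij_betw \<sigma> S {..<card S}" by simp
    have \<sigma>Y: "\<sigma> y < card Y" if "y \<in> Y" for y
      using \<open>bij_betw \<sigma> Y {..<card Y}\<close> that by (auto dest: bij_betwE)
    have "{(x, y) \<in> ?H. \<sigma> y \<le> \<sigma> x} \<subseteq> {(x, y) \<in> H \<inter> X \<times> X. \<pi> y \<le> \<pi> x} \<union>
       {(x, y) \<in> H \<inter> Y \<times> Y. \<rho> y \<le> \<rho> x} \<union> (?H \<inter> X \<times> Y)" (is "_ \<subseteq> ?P \<union> ?Q \<union> ?T")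
      using \<sigma>Y by (auto simp: \<sigma>_def Y_def split: if_splits) (metis DiffI add_leE leD)+
    moreover have finPQ: "finite ?P" "finite ?Q" "finite ?T"
      using fin by (auto intro: finite_subset[of _ "X \<times> X"] finite_subset[of _ "Y \<times> Y"])
    ultimately have "card {(x, y) \<in> ?H. \<sigma> y \<le> \<sigma> x} \<le> card (?P \<union> ?Q \<union> ?T)"
      by (intro card_mono) auto
    also have "\<dots> \<le> card ?P + card ?Q + card ?T"
      by (meson add_le_mono1 card_Un_le le_trans)
    finally have "R\<^sup>2 * card {(x, y) \<in> ?H. \<sigma> y \<le> \<sigma> x} \<le> R\<^sup>2 * (card ?P + card ?Q + card ?T)"
      by (rule mult_le_mono2)
    also have "\<dots> \<le> 2 * (card X)\<^sup>2 + 2 * (card Y)\<^sup>2 + 4 * card X * card Y"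
      using \<pi>(2) \<rho>(2) X(3) unfolding Y_def[symmetric] by (simp add: distrib_left)
    also have "\<dots> = 2 * (card S)\<^sup>2" by (simp add: cardS power2_eq_square algebra_simps)
    finally show ?thesis using bij by blast
  qed
qed

subsection \<open>Sparsity of minimally Eulerian digraphs\<close>

text \<open>A shortest closed walk of positive length repeats no vertex, hence no arc, so
  \<open>balanced_closed_trail\<close> applies to it.\<close>

lemma closed_walk_contains_balanced:
  fixes E :: "('a \<times> 'a) set"
  assumes "0 < j" and "(x, x) \<in> E ^^ j"
  shows "\<exists>C\<subseteq>E. C \<noteq> {} \<and> balanced C \<and> card C \<le> j"
proof -
  define P where "P j \<longleftrightarrow> 0 < j \<and> (\<exists>x. (x, x) \<in> E ^^ j)" for j
  define k where "k = (LEAST j. P j)"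
  have "P j" using assms by (auto simp: P_def)
  then have "P k" and "k \<le> j" unfolding k_def by (auto intro: LeastI Least_le)
  have least: "k \<le> i" if "P i" for i using that unfolding k_def by (rule Least_le)
  obtain f where f: "f 0 = f k" "\<And>i. i < k \<Longrightarrow> (f i, f (Suc i)) \<in> E"
    using \<open>P k\<close> unfolding P_def relpow_fun_conv by metis
  have "f a \<noteq> f b" if "a < b" "b < k" for a b
  proof
    assume "f a = f b"
    then have "(f a, f a) \<in> E ^^ (b - a)"
      unfolding relpow_fun_conv using f(2) that by (intro exI[of _ "\<lambda>i. f (a + i)"]) auto
    then have "P (b - a)" using that by (auto simp: P_def)
    then show False using least[of "b - a"] that by linarith
  qed
  then have "inj_on f {0..<k}" by (auto simp: inj_on_def) (metis linorder_neqE_nat)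
  then have inj: "inj_on (\<lambda>i. (f i, f (Suc i))) {0..<k}" by (auto simp: inj_on_def)
  let ?C = "(\<lambda>i. (f i, f (Suc i))) ` {0..<k}"
  have "balanced ?C" using balanced_closed_trail[OF inj _ f(1)] by simp
  moreover have "?C \<subseteq> E" using f(2) by auto
  moreover have "?C \<noteq> {}" using \<open>P k\<close> by (auto simp: P_def)
  moreover have "card ?C \<le> j" using card_image_le[of "{0..<k}"] \<open>k \<le> j\<close> by (auto intro: le_trans)
  ultimately show ?thesis by blast
qed

text \<open>Arcs are split into backward ones \<open>B\<close>, forward ones \<open>F\<close> of
  displacement at most \<open>s\<close>, and longer ones \<open>L\<close>. An arc of
  \<open>F\<close> is determined by its start and its displacement. Each arc of \<open>L\<close>
  adds more than \<open>s\<close> to the total displacement, which only \<open>B\<close> can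
  compensate, by at most \<open>card U\<close> per arc.\<close>

lemma ordered_arcs_bound:
  fixes \<pi> :: "'a \<Rightarrow> nat"
  assumes "finite U" and bij: "bij_betw \<pi> U {..<card U}" and "H \<subseteq> U \<times> U" and "s > 0"
    and drift: "(\<Sum>(x, y)\<in>H. int (\<pi> y) - int (\<pi> x)) \<le> int D"
  shows "s * card H \<le> s\<^sup>2 * card U + D + (card U + s) * card {(x, y) \<in> H. \<pi> y \<le> \<pi> x}"
proof -
  define u where "u = card U"
  define B where "B = {(x, y) \<in> H. \<pi> y \<le> \<pi> x}"
  define F where "F = {(x, y) \<in> H. \<pi> x < \<pi> y \<and> \<pi> y \<le> \<pi> x + s}"
  define L where "L = {(x, y) \<in> H. \<pi> x + s < \<pi> y}"
  have \<pi>: "\<pi> x < u" if "x \<in> U" for x using bij that by (auto simp: u_def dest: bij_betwE)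
  have finH: "finite H" using assms(1,3) by (meson finite_SigmaI finite_subset)
  have H: "H = B \<union> F \<union> L" "B \<inter> F = {}" "(B \<union> F) \<inter> L = {}" by (auto simp: B_def F_def L_def)
  then have fin: "finite B" "finite F" "finite L" using finH by auto
  have card_H: "card H = card B + card F + card L"
    unfolding H(1) using H(2,3) fin by (simp add: card_Un_disjoint)
  have "card F \<le> card ({..<u} \<times> {1..s})"
  proof (rule card_inj_on_le)
    show "inj_on (\<lambda>(x, y). (\<pi> x, \<pi> y - \<pi> x)) F"
    proof (rule inj_onI, clarify)
      fix a b c d
      assume *: "(a, b) \<in> F" "(c, d) \<in> F" "\<pi> a = \<pi> c" "\<pi> b - \<pi> a = \<pi> d - \<pi> c"
      then have U: "a \<in> U" "b \<in> U" "c \<in> U" "d \<in> U" using assms(3) by (auto simp: F_def)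
      have "\<pi> b = \<pi> d" using * by (auto simp: F_def)
      then show "a = c \<and> b = d" using *(3) U bij by (auto simp: bij_betw_def inj_on_def)
    qed
    show "(\<lambda>(x, y). (\<pi> x, \<pi> y - \<pi> x)) ` F \<subseteq> {..<u} \<times> {1..s}"
      using \<pi> assms(3) by (auto simp: F_def)
  qed simp
  then have F: "card F \<le> u * s" by simp
  let ?\<delta> = "\<lambda>(x, y). int (\<pi> y) - int (\<pi> x)"
  have "sum ?\<delta> H = sum ?\<delta> B + sum ?\<delta> F + sum ?\<delta> L"
    unfolding H(1) using H(2,3) fin by (simp add: sum.union_disjoint)
  moreover have "(\<Sum>e\<in>B. - int u) \<le> sum ?\<delta> B"
    by (rule sum_mono) (use \<pi> assms(3) in \<open>force simp: B_def\<close>)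
  moreover have "0 \<le> sum ?\<delta> F" by (rule sum_nonneg) (auto simp: F_def)
  moreover have "(\<Sum>e\<in>L. int s) \<le> sum ?\<delta> L" by (rule sum_mono) (auto simp: L_def)
  ultimately have "int s * int (card L) \<le> int D + int u * int (card B)"
    using drift by (simp add: algebra_simps)
  then have "s * card L \<le> D + u * card B"
    by (simp flip: of_nat_mult of_nat_add)
  moreover have "s * card F \<le> s * (u * s)" using F by (rule mult_le_mono2)
  moreover have "s * card H = s * card B + s * card F + s * card L"
    by (simp add: card_H distrib_left)
  moreover have "s\<^sup>2 * u + D + (u + s) * card B = s * (u * s) + D + (u * card B + s * card B)"
    by (simp add: algebra_simps power2_eq_square)
  ultimately have "s * card H \<le> s\<^sup>2 * u + D + (u + s) * card B" by linarith
  then show ?thesis unfolding B_def u_def .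
qed

text \<open>A maximal packing of short cycles takes up at most \<open>2 * R * u\<close> arcs, and
  the remainder \<open>H'\<close>, which has no short closed walks, at most
  \<open>7 * R * u\<close>. The hypothesis \<open>drift\<close> stands for a union of
  \<open>u + 1\<close> walks inside \<open>U\<close>; it is required for all \<open>\<phi>\<close>
  because the ordering is chosen only in the proof.\<close>

lemma minimally_eulerian_sparse:
  assumes min: "minimally_eulerian V A" and "finite U" "U \<noteq> {}" and H: "H \<subseteq> A \<inter> U \<times> U"
    and R: "card U \<le> R\<^sup>2"
    and drift: "\<And>\<phi> :: 'a \<Rightarrow> nat. (\<And>v. v \<in> U \<Longrightarrow> \<phi> v < card U) \<Longrightarrow>
        (\<Sum>(x, y)\<in>H. int (\<phi> y) - int (\<phi> x)) \<le> int ((card U + 1) * card U)"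
  shows "card H \<le> 9 * R * card U"
proof -
  define u where "u = card U"
  have "u > 0" using assms(2,3) by (simp add: u_def card_gt_0_iff)
  with R have "R > 0" by (auto simp: u_def intro: gr0I)
  have finH: "finite H" using assms(2) H by (meson finite_SigmaI finite_subset le_infE)
  define Q where "Q = {C. C \<subseteq> H \<and> C \<noteq> {} \<and> balanced C \<and> card C \<le> 2 * R}"
  define F where "F = {\<C>. \<C> \<subseteq> Q \<and> pairwise disjnt \<C>}"
  have "F \<subseteq> Pow (Pow H)" by (auto simp: F_def Q_def)
  then have "finite F" using finH finite_subset by blast
  moreover have "{} \<in> F" by (simp add: F_def)
  ultimately obtain \<C> where \<C>: "\<C> \<in> F" and max: "\<And>\<D>. \<D> \<in> F \<Longrightarrow> \<C> \<subseteq> \<D> \<Longrightarrow> \<C> = \<D>"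
    using finite_has_maximal[of F] by auto
  have \<C>Q: "C \<subseteq> H" "C \<noteq> {}" "balanced C" "card C \<le> 2 * R" if "C \<in> \<C>" for C
    using \<C> that by (auto simp: F_def Q_def)
  have disj: "pairwise disjnt \<C>" using \<C> by (simp add: F_def)
  have fin\<C>: "finite \<C>" using \<C>Q(1) finH by (meson PowI finite_Pow_iff finite_subset subsetI)
  have card\<C>: "card \<C> < u"
    unfolding u_def using H \<C>Q by (intro card_packing_less[OF min assms(2,3) fin\<C> _ disj]) blast
  define H' where "H' = H - \<Union>\<C>"
  have "card (\<Union>\<C>) \<le> (\<Sum>C\<in>\<C>. card C)" by (rule card_Union_le_sum_card)
  also have "\<dots> \<le> card \<C> * (2 * R)" using \<C>Q(4) by (intro sum_bounded_above[where 'a = nat, simplified]) auto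
  also have "\<dots> \<le> u * (2 * R)" using card\<C> by simp
  finally have card_Union: "card (\<Union>\<C>) \<le> 2 * R * u" by (simp add: ac_simps)
  have girth: "(x, x) \<notin> H' ^^ j" if j: "0 < j" "j \<le> 2 * R" for j x
  proof
    assume walk: "(x, x) \<in> H' ^^ j"
    obtain C where C: "C \<subseteq> H'" "C \<noteq> {}" "balanced C" "card C \<le> j"
      using closed_walk_contains_balanced[OF j(1) walk] by blast
    have "disjnt C D \<and> disjnt D C" if "D \<in> \<C>" for D
      using C(1) that by (auto simp: H'_def disjnt_def)
    then have "pairwise disjnt (insert C \<C>)" using disj by (simp add: pairwise_insert)
    moreover have "C \<in> Q" using C j(2) by (simp add: Q_def H'_def subset_Diff_insert subset_iff)
    moreover have "\<C> \<subseteq> Q" using \<C> by (simp add: F_def)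
    ultimately have "insert C \<C> \<in> F" by (simp add: F_def)
    then have "C \<in> \<C>" using max[of "insert C \<C>"] by auto
    then show False using C(1,2) by (auto simp: H'_def)
  qed
  obtain \<pi> where \<pi>: "bij_betw \<pi> U {..<u}"
    and backward: "R\<^sup>2 * card {(x, y) \<in> H' \<inter> U \<times> U. \<pi> y \<le> \<pi> x} \<le> 2 * u\<^sup>2"
    using almost_acyclic_ordering[OF assms(2) \<open>R > 0\<close> girth] unfolding u_def by blast
  have H'U: "H' \<subseteq> U \<times> U" "H' \<inter> U \<times> U = H'" using H by (auto simp: H'_def)
  define b where "b = card {(x, y) \<in> H'. \<pi> y \<le> \<pi> x}"
  \<comment> \<open>The assumption \<open>R\<close> turns the bound
    \<open>2 * u\<^sup>2 / R\<^sup>2\<close> on backward arcs into one linear in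
    \<open>u\<close>.\<close>
  have "2 * u\<^sup>2 \<le> R\<^sup>2 * (2 * u)" using R by (simp add: u_def power2_eq_square)
  with backward have "R\<^sup>2 * b \<le> R\<^sup>2 * (2 * u)" unfolding b_def H'U(2) by (rule le_trans)
  then have b: "b \<le> 2 * u" using \<open>R > 0\<close> by simp
  let ?\<delta> = "\<lambda>(x, y). int (\<pi> y) - int (\<pi> x)"
  \<comment> \<open>The packed cycles have total displacement zero, so \<open>H'\<close> inherits
    the drift bound of \<open>H\<close>.\<close>
  have "sum ?\<delta> (\<Union>\<C>) = (sum \<circ> sum) ?\<delta> \<C>"
  proof (rule sum.Union_disjoint)
    show "\<forall>C\<in>\<C>. finite C" using \<C>Q(1) finH finite_subset by blast
    show "\<forall>C\<in>\<C>. \<forall>D\<in>\<C>. C \<noteq> D \<longrightarrow> C \<inter> D = {}"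
      using disj by (auto simp: pairwise_def disjnt_def)
  qed
  also have "\<dots> = (\<Sum>C\<in>\<C>. sum ?\<delta> C)" by simp
  also have "\<dots> = 0"
    using \<C>Q(1,3) finH by (intro sum.neutral ballI balanced_sum_eq_0) (auto intro: finite_subset)
  finally have "sum ?\<delta> H' = sum ?\<delta> H"
    unfolding H'_def using \<C>Q(1) finH by (subst sum_diff) auto
  also have "\<dots> \<le> int ((u + 1) * u)"
    unfolding u_def using \<pi> by (intro drift) (auto simp: u_def dest: bij_betwE)
  \<comment> \<open>Here \<open>s = R\<close>, which balances the short arcs, about
    \<open>R * u\<close> of them, against the long ones. The rest of the chain uses
    \<open>u \<le> R\<^sup>2\<close> to make every term a multiple of
    \<open>R\<^sup>2 * u\<close>.\<close>
  finally have "R * card H' \<le> R\<^sup>2 * u + (u + 1) * u + (u + R) * b"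
    using ordered_arcs_bound[OF assms(2) _ H'U(1) \<open>R > 0\<close>] \<pi> unfolding b_def u_def by blast
  also have "\<dots> \<le> R\<^sup>2 * u + (u + u) * u + (u + R) * (2 * u)"
    using b \<open>u > 0\<close> by (intro add_mono mult_le_mono) auto
  also have "\<dots> = R\<^sup>2 * u + 4 * u * u + 2 * R * u" by (simp add: algebra_simps)
  also have "\<dots> \<le> R\<^sup>2 * u + 4 * R\<^sup>2 * u + 2 * R\<^sup>2 * u"
    using R \<open>R > 0\<close> by (intro add_mono mult_le_mono) (auto simp: u_def power2_eq_square)
  also have "\<dots> = R * (7 * R * u)" by (simp add: power2_eq_square)
  finally have "card H' \<le> 7 * R * u" using \<open>R > 0\<close> by simp
  moreover have "\<Union>\<C> \<subseteq> H" using \<C>Q(1) by blast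
  then have "card H = card H' + card (\<Union>\<C>)"
    unfolding H'_def using finH card_mono[of H "\<Union>\<C>"]
    by (simp add: card_Diff_subset finite_subset)
  ultimately show ?thesis using card_Union by (simp add: u_def)
qed

subsection \<open>Hall's theorem\<close>

lemma inj_on_disjoint_If:
  assumes "inj_on h J" and "inj_on g (I - J)" and "h ` J \<inter> g ` (I - J) = {}"
  shows "inj_on (\<lambda>i. if i \<in> J then h i else g i) I"
  using assms unfolding inj_on_def by (simp add: disjoint_iff) blast

text \<open>A tight proper subfamily is represented first and its union removed from the other sets,
  which preserves the condition. If none is tight, every nonempty proper subfamily has an element to
  spare, so any choice for one index can be extended.\<close>

theorem hall:
  assumes "finite I" and "\<And>i. i \<in> I \<Longrightarrow> finite (W i)"
    and "\<And>J. J \<subseteq> I \<Longrightarrow> card J \<le> card (\<Union>(W ` J))"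
  shows "\<exists>h. inj_on h I \<and> (\<forall>i\<in>I. h i \<in> W i)"
  using assms
proof (induction "card I" arbitrary: I W rule: less_induct)
  case less
  note finW = less.prems(2) and cond = less.prems(3)
  have finJ: "finite J" if "J \<subseteq> I" for J using that less.prems(1) finite_subset by blast
  have finU: "finite (\<Union>(W ` J))" if "J \<subseteq> I" for J using that finJ finW by blast
  show ?case
  proof (cases "\<exists>J. J \<noteq> {} \<and> J \<subset> I \<and> card (\<Union>(W ` J)) = card J")
    case True
    then obtain J where J: "J \<noteq> {}" "J \<subset> I" "card (\<Union>(W ` J)) = card J" by blast
    let ?U = "\<Union>(W ` J)"
    have "card J < card I" using J(2) less.prems(1) by (intro psubset_card_mono)
    then have "\<exists>h. inj_on h J \<and> (\<forall>i\<in>J. h i \<in> W i)"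
      by (rule less.hyps) (use J(2) finJ finW cond in blast)+
    then obtain h where h: "inj_on h J" "\<forall>i\<in>J. h i \<in> W i" by blast
    have less: "card (I - J) < card I"
      using J(1,2) less.prems(1) by (intro psubset_card_mono) auto
    have cond': "card K \<le> card (\<Union>((\<lambda>i. W i - ?U) ` K))" if K: "K \<subseteq> I - J" for K
    proof -
      have "card J + card K = card (J \<union> K)"
        using K J(2) finJ by (intro card_Un_disjoint[symmetric]) auto
      also have "\<dots> \<le> card (\<Union>(W ` (J \<union> K)))" using K J(2) by (intro cond) auto
      also have "\<Union>(W ` (J \<union> K)) = ?U \<union> \<Union>((\<lambda>i. W i - ?U) ` K)" by auto
      also have "card \<dots> \<le> card ?U + card (\<Union>((\<lambda>i. W i - ?U) ` K))" by (rule card_Un_le)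
      finally show ?thesis using J(3) by simp
    qed
    have "\<exists>g. inj_on g (I - J) \<and> (\<forall>i\<in>I - J. g i \<in> W i - ?U)"
    proof (rule less.hyps[OF less])
      show "finite (I - J)" by (rule finJ) blast
      show "finite (W i - ?U)" if "i \<in> I - J" for i using finW that by simp
    qed (rule cond')
    then obtain g where g: "inj_on g (I - J)" "\<forall>i\<in>I - J. g i \<in> W i - ?U" by blast
    show ?thesis
    proof (intro exI conjI)
      show "inj_on (\<lambda>i. if i \<in> J then h i else g i) I"
        using h(1) g(1)
      proof (rule inj_on_disjoint_If)
        have "h ` J \<subseteq> ?U" using h(2) by auto
        moreover have "g ` (I - J) \<subseteq> - ?U" using g(2) by auto
        ultimately show "h ` J \<inter> g ` (I - J) = {}" by blast
      qed
      show "\<forall>i\<in>I. (if i \<in> J then h i else g i) \<in> W i" using h g by auto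
    qed
  next
    case no_tight: False
    show ?thesis
    proof (cases "I = {}")
      case False
      then obtain i where i: "i \<in> I" by blast
      have "card {i} \<le> card (\<Union>(W ` {i}))" using i by (intro cond) auto
      then have "W i \<noteq> {}" by (intro notI) simp
      then obtain x where x: "x \<in> W i" by blast
      let ?W = "\<lambda>j. W j - {x}"
      have less: "card (I - {i}) < card I"
        using i less.prems(1) by (intro psubset_card_mono) auto
      have cond': "card K \<le> card (\<Union>(?W ` K))" if K: "K \<subseteq> I - {i}" for K
      proof (cases "K = {}")
        case False
        have "K \<subset> I" using K i by auto
        then have "card (\<Union>(W ` K)) \<noteq> card K" "card K \<le> card (\<Union>(W ` K))"
          using False no_tight cond[of K] by auto
        moreover have "\<Union>(?W ` K) = \<Union>(W ` K) - {x}" by auto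
        ultimately show ?thesis by (auto simp: card_Diff_singleton_if)
      qed simp
      have "\<exists>g. inj_on g (I - {i}) \<and> (\<forall>j\<in>I - {i}. g j \<in> ?W j)"
      proof (rule less.hyps[OF less])
        show "finite (I - {i})" by (rule finJ) blast
        show "finite (?W j)" if "j \<in> I - {i}" for j using finW that by simp
      qed (rule cond')
      then obtain g where g: "inj_on g (I - {i})" "\<forall>j\<in>I - {i}. g j \<in> ?W j" by blast
      show ?thesis
      proof (intro exI conjI)
        show "inj_on (g(i := x)) I" using g by (auto simp: inj_on_def)
        show "\<forall>j\<in>I. (g(i := x)) j \<in> W j" using g x by auto
      qed
    qed auto
  qed
qed

subsection \<open>Eulerian tours\<close>

text \<open>Brings the recursive predicate \<open>cas\<close> into index form, as needed to read a
  trail as a sequence of positions.\<close>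

lemma cas_nth:
  assumes "pre_digraph.cas G u p v" and "p \<noteq> []"
  shows "tail G (p ! 0) = u \<and> (\<forall>i. Suc i < length p \<longrightarrow> head G (p ! i) = tail G (p ! Suc i))
    \<and> head G (last p) = v"
  using assms
proof (induction p arbitrary: u)
  case (Cons a p)
  then have cas: "tail G a = u" "pre_digraph.cas G (head G a) p v"
    by (auto simp: pre_digraph.cas.simps)
  show ?case
  proof (cases "p = []")
    case True
    then show ?thesis using cas by (simp add: pre_digraph.cas.simps)
  next
    case False
    with Cons.IH[OF cas(2)] cas(1) show ?thesis by (auto simp: nth_Cons split: nat.split)
  qed
qed simp

text \<open>The tour is unrolled to a periodic sequence, so that a piece running past its starting
  point is still an interval of positions.\<close>

lemma euler_tour:
  assumes "simple_digraph V A" and "Defs.eulerian V A" and "A \<noteq> {}"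
  obtains w :: "nat \<Rightarrow> 'a" and m :: nat where "m > 0"
    and "bij_betw (\<lambda>p. (w p, w (Suc p))) {..<m} A" and "\<And>p. w (p + m) = w p"
proof -
  define G where "G = \<lparr> verts = V, arcs = A, tail = fst, head = snd \<rparr>"
  have fin: "finite V" "A \<subseteq> V \<times> V" using assms(1) by (auto simp: simple_digraph_def)
  then have finA: "finite A" by (meson finite_SigmaI finite_subset)
  interpret G: fin_digraph G
    by unfold_locales (insert fin finA, auto simp: G_def)
  have sym: "parcs (mk_symmetric G) = A \<union> A\<inverse>"
    unfolding parcs_mk_symmetric by (auto simp: G_def)
  \<comment> \<open>Reachability confined to \<open>V\<close> agrees with ordinary reachability
    because all arcs stay in \<open>V\<close>.\<close>
  have "rtrancl_on V (A \<union> A\<inverse>) = Restr ((A \<union> A\<inverse>)\<^sup>*) V"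
  proof -
    have "(x, y) \<in> rtrancl_on V (A \<union> A\<inverse>)" if "(x, y) \<in> (A \<union> A\<inverse>)\<^sup>*" "x \<in> V" for x y
      using that
    proof (induction rule: rtrancl_induct)
      case base then show ?case by simp
    next
      case (step y z)
      then have "z \<in> V" using fin(2) by auto
      with step show ?case by (auto intro: rtrancl_on_into_rtrancl_on)
    qed
    moreover have "(x, y) \<in> (A \<union> A\<inverse>)\<^sup>* \<and> x \<in> V \<and> y \<in> V" if "(x, y) \<in> rtrancl_on V (A \<union> A\<inverse>)" for x y
      using that by induction (auto intro: converse_rtrancl_into_rtrancl)
    ultimately show ?thesis by auto
  qed
  then have "Digraph_Component.connected G"
    using assms(2) sym
    by (auto simp: connected_def strongly_connected_def reachable_def eulerian_def
        digraph_connected_def G_def)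
  moreover have "Digraph.in_degree G u = Digraph.out_degree G u" if "u \<in> verts G" for u
  proof -
    have "in_arcs G u = (\<lambda>x. (x, u)) ` {x. (x, u) \<in> A}" "out_arcs G u = (\<lambda>x. (u, x)) ` {x. (u, x) \<in> A}"
      by (auto simp: in_arcs_def out_arcs_def G_def)
    then have "Digraph.in_degree G u = Defs.in_degree A u" "Digraph.out_degree G u = Defs.out_degree A u"
      by (auto simp: Digraph.in_degree_def Digraph.out_degree_def Defs.in_degree_def Defs.out_degree_def
          card_image inj_on_def)
    then show ?thesis using assms(2) that by (simp add: eulerian_def G_def)
  qed
  ultimately obtain u p where "G.euler_trail u p u" using G.closed_euler1 by blast
  then have p: "set p = arcs G" "distinct p" "G.cas u p u"
    unfolding G.euler_trail_def G.trail_def G.awalk_def by blast+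
  have "arcs G = A" by (simp add: G_def)
  note p = p(1)[unfolded this] p(2,3)
  with \<open>A \<noteq> {}\<close> have ne: "p \<noteq> []" by auto
  define m where "m = length p"
  \<comment> \<open>Reducing modulo \<open>m\<close> makes the last arc end where the first one
    starts.\<close>
  define w where "w i = fst (p ! (i mod m))" for i
  have arc: "(w i, w (Suc i)) = p ! i" if "i < m" for i
  proof (cases "Suc i < m")
    case True
    then show ?thesis using cas_nth[OF p(3) ne] that
      by (auto simp: w_def m_def G_def prod_eq_iff)
  next
    case False
    then have "Suc i = m" using that by simp
    then have "last p = p ! i" using ne by (metis diff_Suc_1 last_conv_nth m_def)
    then show ?thesis using cas_nth[OF p(3) ne] that \<open>Suc i = m\<close>
      by (auto simp: w_def m_def G_def prod_eq_iff)
  qed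
  have "bij_betw ((!) p) {..<m} A"
    using p by (auto simp: m_def intro: bij_betw_nth)
  then have "bij_betw (\<lambda>i. (w i, w (Suc i))) {..<m} A"
    by (rule bij_betw_cong[THEN iffD1, rotated]) (use arc in auto)
  moreover have "m > 0" using ne by (simp add: m_def)
  moreover have "w (i + m) = w i" for i by (simp add: w_def)
  ultimately show thesis using that by blast
qed

section \<open>Tours of minimally Eulerian digraphs\<close>

locale minimal_tour =
  fixes V :: "'a set" and A and w :: "nat \<Rightarrow> 'a" and m :: nat
  assumes minimal: "minimally_eulerian V A" and card_V: "card V > 1" and m_pos: "m > 0"
    and tour: "bij_betw (\<lambda>p. (w p, w (Suc p))) {..<m} A" and period: "w (p + m) = w p"
begin

definition arc :: "nat \<Rightarrow> 'a \<times> 'a" where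
  "arc p = (w p, w (Suc p))"

lemma fin: "finite V" "A \<subseteq> V \<times> V" "finite A"
proof -
  show *: "finite V" "A \<subseteq> V \<times> V"
    using minimal by (auto simp: minimally_eulerian_def simple_digraph_def)
  then show "finite A" by (meson finite_SigmaI finite_subset)
qed

lemma w_mod: "w (p mod m) = w p"
proof -
  have "w (q + k * m) = w q" for q k
    by (induction k) (use period[of "q + _ * m"] in \<open>auto simp: ac_simps\<close>)
  from this[of "p mod m" "p div m"] show ?thesis by (simp add: add.commute)
qed

lemma arc_mod: "arc (p mod m) = arc p"
  using w_mod[of p] w_mod[of "Suc p"] w_mod[of "Suc (p mod m)"] by (simp add: arc_def mod_Suc_eq)

lemma tour': "bij_betw arc {..<m} A"
  using tour by (simp add: arc_def[abs_def])

lemma arc_in: "arc p \<in> A"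
  using bij_betwE[OF tour'] m_pos by (metis arc_mod lessThan_iff mod_less_divisor)

lemma w_in: "w p \<in> V"
  using arc_in[of p] fin(2) by (auto simp: arc_def)

lemma arc_eqD: "arc p = arc q \<Longrightarrow> p mod m = q mod m"
  using bij_betw_imp_inj_on[OF tour'] m_pos
  by (metis arc_mod inj_onD lessThan_iff mod_less_divisor)

lemma arc_inj: "b \<le> a + m \<Longrightarrow> inj_on arc {a..<b}"
proof (rule inj_onI)
  fix p q assume b: "b \<le> a + m" and pq: "p \<in> {a..<b}" "q \<in> {a..<b}" "arc p = arc q"
  have "x = y" if "x mod m = y mod m" "x \<le> y" "y < x + m" for x y
  proof -
    have "m dvd y - x" using that by (metis mod_eq_dvd_iff_nat)
    moreover have "y - x < m" using that(2,3) by linarith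
    ultimately have "y - x = 0" using nat_dvd_not_less by blast
    then show ?thesis using that(2) by simp
  qed
  moreover have "p mod m = q mod m" using pq(3) by (rule arc_eqD)
  moreover have "p < q + m" "q < p + m" using pq(1,2) b by auto
  ultimately show "p = q" by (metis nat_le_linear)
qed

lemma arc_window: "arc ` {a..<a + m} = A"
proof -
  have "arc ` {a..<a + m} \<subseteq> A" using arc_in by auto
  moreover have "card (arc ` {a..<a + m}) = m" using arc_inj[of "a + m" a] by (simp add: card_image)
  moreover have "card A = m" using bij_betw_same_card[OF tour'] by simp
  ultimately show ?thesis using fin(3) by (intro card_subset_eq) auto
qed

lemma w_surj: "x \<in> V \<Longrightarrow> \<exists>p<m. w p = x"
proof -
  assume x: "x \<in> V"
  \<comment> \<open>A second vertex, linked to \<open>x\<close> by connectedness, provides an arc at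
    \<open>x\<close>, so the tour visits \<open>x\<close>.\<close>
  have "V \<noteq> {x}" using card_V by auto
  then obtain y where y: "y \<in> V" "y \<noteq> x" using x by blast
  then have "(x, y) \<in> (A \<union> A\<inverse>)\<^sup>*"
    using minimal x by (auto simp: minimally_eulerian_def eulerian_def digraph_connected_def)
  then obtain z where "(x, z) \<in> A \<or> (z, x) \<in> A"
    using y(2) by (auto elim: converse_rtranclE)
  then obtain p where "w p = x"
    using bij_betw_imp_surj_on[OF tour'] by (auto simp: arc_def)
  then show ?thesis using w_mod[of p] m_pos by (intro exI[of _ "p mod m"]) simp
qed

text \<open>Removing a closed subwalk would leave a connected spanning Eulerian subgraph.\<close>
lemma no_repetition:
  assumes "a < b" and "b \<le> a + m" and cover: "V \<subseteq> w ` {b..a + m}"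
  shows "w a \<noteq> w b"
proof
  assume closed: "w a = w b"
  define C where "C = arc ` {a..<b}"
  have "balanced C"
    unfolding C_def using balanced_closed_trail[of w a b] arc_inj[OF assms(2)] closed assms(1)
    by (simp add: arc_def[abs_def])
  moreover have C: "C \<subseteq> A" "C \<noteq> {}" using arc_in assms(1) by (auto simp: C_def)
  ultimately have *: "\<not> C \<subseteq> linked (A - C)" using minimally_eulerian_Diff[OF minimal] by blast
  have step: "arc p \<in> A - C" if "b \<le> p" "p < a + m" for p
  proof -
    have "arc p \<notin> C"
    proof
      assume "arc p \<in> C"
      then obtain q where q: "q \<in> {a..<b}" "arc p = arc q" by (auto simp: C_def)
      then have "p = q" using that assms(1,2) by (intro inj_onD[OF arc_inj[of "a + m" a]]) auto
      then show False using q(1) that(1) by simp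
    qed
    then show ?thesis using arc_in by simp
  qed
  \<comment> \<open>The rest of the tour, from \<open>b\<close> to \<open>a + m\<close>, survives
    the deletion of \<open>C\<close>, and by \<open>cover\<close> it visits every vertex.\<close>
  have link: "(w b, w p) \<in> linked (A - C)" if "b \<le> p" "p \<le> a + m" for p
    using that
  proof (induction p rule: dec_induct)
    case base
    show ?case by simp
  next
    case (step p)
    then have "(w p, w (Suc p)) \<in> linked (A - C)"
      using \<open>\<And>p. b \<le> p \<Longrightarrow> p < a + m \<Longrightarrow> arc p \<in> A - C\<close>[of p] subset_linked[of "A - C"]
      by (auto simp: arc_def)
    then show ?case using step by (auto intro: linked_trans)
  qed
  have "(w b, x) \<in> linked (A - C)" if "x \<in> V" for x
    using cover that link by auto
  then have "(x, y) \<in> linked (A - C)" if "x \<in> V" "y \<in> V" for x y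
    using that by (meson linked_sym linked_trans)
  then show False using * C(1) fin(2) by auto
qed

text \<open>A violation puts \<open>u + 1\<close> disjoint intervals inside a set \<open>U\<close>
  of \<open>u\<close> vertices. Their \<open>(u + 1) * (9 * R)\<close> arcs exceed the bound of
  \<open>minimally_eulerian_sparse\<close>.\<close>

lemma intervals_hall:
  assumes R: "card V \<le> R\<^sup>2" and l: "l = 9 * R + 1" and r: "r * l \<le> m" and J: "J \<subseteq> {..<r}"
  shows "card J \<le> card (\<Union>j\<in>J. w ` {j * l..<j * l + l})"
proof (rule ccontr)
  define U where "U = (\<Union>j\<in>J. w ` {j * l..<j * l + l})"
  assume "\<not> ?thesis"
  then have less: "card U < card J" by (simp add: U_def)
  have "R > 0" using R card_V by (auto intro: gr0I)
  \<comment> \<open>Exactly \<open>card U + 1\<close> intervals are kept, because the drift bound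
    grows with their number.\<close>
  obtain J' where J': "J' \<subseteq> J" "card J' = card U + 1" "finite J'"
    using less by (metis Suc_eq_plus1 Suc_leI obtain_subset_with_card_n)
  have "U \<subseteq> V" using w_in by (auto simp: U_def)
  then have finU: "finite U" "card U \<le> R\<^sup>2"
    using fin(1) finite_subset card_mono[OF fin(1)] R by (blast, meson le_trans)
  have "J' \<noteq> {}" using J'(2) by auto
  then obtain j where "j \<in> J" using J'(1) by blast
  then have "w (j * l) \<in> U" unfolding U_def l by force
  then have "U \<noteq> {}" by auto
  \<comment> \<open>Of the \<open>l\<close> positions of an interval the last one is dropped, since
    the arc starting there leaves the interval.\<close>
  define I where "I j = {j * l..<j * l + 9 * R}" for j
  define P where "P = (\<Union>j\<in>J'. I j)"
  have I_disj: "I i \<inter> I j = {}" if "i < j" for i j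
  proof -
    have "Suc i * l \<le> j * l" using that by (intro mult_le_mono1) simp
    then show ?thesis by (auto simp: I_def l)
  qed
  then have disj: "\<forall>i\<in>J'. \<forall>j\<in>J'. i \<noteq> j \<longrightarrow> I i \<inter> I j = {}"
    by (metis Int_commute linorder_neqE_nat)
  have Pm: "P \<subseteq> {0..<m}"
  proof
    fix p assume "p \<in> P"
    then obtain j where j: "j \<in> J'" "p \<in> I j" by (auto simp: P_def)
    then have "Suc j * l \<le> r * l" using J J'(1) by (intro mult_le_mono1) auto
    then show "p \<in> {0..<m}" using j(2) r by (auto simp: I_def l)
  qed
  then have inj: "inj_on arc P" using arc_inj[of m 0] by (auto intro: inj_on_subset)
  define H where "H = arc ` P"
  have "card H = card P" unfolding H_def using inj by (rule card_image)
  also have "\<dots> = (\<Sum>j\<in>J'. card (I j))"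
    unfolding P_def using J'(3) disj by (intro card_UN_disjoint) (auto simp: I_def)
  also have "\<dots> = (card U + 1) * (9 * R)" using J'(2) by (simp add: I_def)
  finally have card_H: "card H = (card U + 1) * (9 * R)" .
  have "card H \<le> 9 * R * card U"
  proof (rule minimally_eulerian_sparse[OF minimal finU(1) \<open>U \<noteq> {}\<close> _ finU(2)])
    have "arc p \<in> U \<times> U" if p: "p \<in> P" for p
    proof -
      obtain j where j: "j \<in> J" "p \<in> I j" using p J'(1) by (auto simp: P_def)
      then have "w p \<in> w ` {j * l..<j * l + l}" "w (Suc p) \<in> w ` {j * l..<j * l + l}"
        by (auto simp: I_def l)
      then show ?thesis using j(1) by (auto simp: U_def arc_def)
    qed
    then have "H \<subseteq> U \<times> U" unfolding H_def by (rule image_subsetI)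
    moreover have "H \<subseteq> A" unfolding H_def using arc_in by (rule image_subsetI)
    ultimately show "H \<subseteq> A \<inter> U \<times> U" by simp
    fix \<phi> :: "'a \<Rightarrow> nat"
    assume \<phi>: "\<And>v. v \<in> U \<Longrightarrow> \<phi> v < card U"
    have "(\<Sum>(x, y)\<in>H. int (\<phi> y) - int (\<phi> x)) = (\<Sum>p\<in>P. int (\<phi> (w (Suc p))) - int (\<phi> (w p)))"
      unfolding H_def by (subst sum.reindex[OF inj]) (simp add: arc_def)
    also have "\<dots> = (\<Sum>j\<in>J'. \<Sum>p\<in>I j. int (\<phi> (w (Suc p))) - int (\<phi> (w p)))"
      unfolding P_def using J'(3) disj by (intro sum.UNION_disjoint) (auto simp: I_def)
    \<comment> \<open>The sum over one interval telescopes to a difference of two values of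
      \<open>\<phi>\<close> on \<open>U\<close>.\<close>
    also have "\<dots> \<le> (\<Sum>j\<in>J'. int (card U))"
    proof (rule sum_mono)
      fix j assume j: "j \<in> J'"
      have "(\<Sum>p\<in>I j. int (\<phi> (w (Suc p))) - int (\<phi> (w p)))
          = int (\<phi> (w (j * l + 9 * R))) - int (\<phi> (w (j * l)))"
        unfolding I_def by (rule sum_Suc_diff') simp
      moreover have "w (j * l + 9 * R) \<in> w ` {j * l..<j * l + l}" by (rule imageI) (simp add: l)
      then have "w (j * l + 9 * R) \<in> U" using j J'(1) unfolding U_def by blast
      ultimately show "(\<Sum>p\<in>I j. int (\<phi> (w (Suc p))) - int (\<phi> (w p))) \<le> int (card U)"
        using \<phi> by fastforce
    qed
    also have "\<dots> = int ((card U + 1) * card U)" using J'(2) by (simp add: distrib_right)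
    finally show "(\<Sum>(x, y)\<in>H. int (\<phi> y) - int (\<phi> x)) \<le> int ((card U + 1) * card U)" .
  qed
  then show False using card_H \<open>R > 0\<close> by simp
qed

end

section \<open>Marks on the tour and the paths between them\<close>

lemma path_arcs_map_upt:
  "path_arcs (map f [a..<Suc b]) = (\<lambda>p. (f p, f (Suc p))) ` {a..<b}"
proof (cases "a \<le> b")
  case True
  have "zip (map f [a..<Suc b]) (map f [Suc a..<Suc b]) = map (\<lambda>p. (f p, f (Suc p))) [a..<b]"
    by (rule nth_equalityI) (auto simp del: upt_Suc)
  moreover have "tl (map f [a..<Suc b]) = map f [Suc a..<Suc b]"
    by (simp add: tl_upt flip: map_tl del: upt_Suc)
  ultimately show ?thesis unfolding path_arcs_def by (simp only: set_map set_upt)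
qed (simp add: path_arcs_def)

context minimal_tour
begin

text \<open>Hall's theorem assigns to each interval a vertex of its own, which is marked at a visit
  inside that interval. A vertex that is not assigned is marked at any visit.\<close>

lemma spread_marks:
  assumes R: "card V \<le> R\<^sup>2" and l: "l = 9 * R + 1" and r: "r * l \<le> m"
  obtains \<mu> where "\<And>x. x \<in> V \<Longrightarrow> \<mu> x < m \<and> w (\<mu> x) = x"
    and "\<And>j. j < r \<Longrightarrow> \<exists>x\<in>V. j * l \<le> \<mu> x \<and> \<mu> x < j * l + l"
proof -
  have "\<exists>h. inj_on h {..<r} \<and> (\<forall>j\<in>{..<r}. h j \<in> w ` {j * l..<j * l + l})"
    by (rule hall) (use intervals_hall[OF R l r] in auto)
  then obtain h where h: "inj_on h {..<r}" "\<And>j. j < r \<Longrightarrow> h j \<in> w ` {j * l..<j * l + l}"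
    by auto
  have "\<exists>p<m. w p = x \<and> (\<forall>j<r. h j = x \<longrightarrow> j * l \<le> p \<and> p < j * l + l)" if x: "x \<in> V" for x
  proof (cases "\<exists>j<r. h j = x")
    case True
    then obtain j where j: "j < r" "h j = x" by blast
    then obtain p where p: "x = w p" "j * l \<le> p" "p < j * l + l" using h(2)[OF j(1)] by auto
    have "Suc j * l \<le> r * l" using j(1) by (intro mult_le_mono1) simp
    then have "p < m" using p(3) r by simp
    moreover have "i = j" if "i < r" "h i = x" for i
      using inj_onD[OF h(1), of i j] that j by simp
    ultimately show ?thesis using p by blast
  next
    case False
    then show ?thesis using w_surj[OF x] by blast
  qed
  then obtain \<mu> where \<mu>: "\<And>x. x \<in> V \<Longrightarrow> \<mu> x < m \<and> w (\<mu> x) = x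
      \<and> (\<forall>j<r. h j = x \<longrightarrow> j * l \<le> \<mu> x \<and> \<mu> x < j * l + l)"
    by metis
  moreover have "\<exists>x\<in>V. j * l \<le> \<mu> x \<and> \<mu> x < j * l + l" if j: "j < r" for j
  proof -
    have "h j \<in> V" using h(2)[OF j] w_in by auto
    then show ?thesis using \<mu> j by blast
  qed
  ultimately show thesis using that by blast
qed

text \<open>The marks in increasing order give the vertex ordering, and the pieces of the tour
  between cyclically consecutive marks are the paths. The bound \<open>card V - 1\<close>, valid for
  any path, serves for small \<open>card V\<close> later.\<close>

lemma path_decomposition:
  assumes R: "card V \<le> R\<^sup>2"
  shows "\<exists>v P. bij_betw v {..<card V} V \<and>
    (\<forall>i<card V. is_dipath A (P i) (v i) (v (Suc i mod card V))) \<and>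
    (\<forall>i<card V. \<forall>j<card V. i \<noteq> j \<longrightarrow> path_arcs (P i) \<inter> path_arcs (P j) = {}) \<and>
    (\<Union>i<card V. path_arcs (P i)) = A \<and>
    (\<forall>i<card V. path_length (P i) \<le> 3 * (9 * R + 1) \<and> path_length (P i) \<le> card V - 1)"
proof -
  define n where "n = card V"
  define l where "l = 9 * R + 1"
  \<comment> \<open>Only full intervals are counted; the fewer than \<open>l\<close> positions left
    at the end of the tour need not contain a mark.\<close>
  define r where "r = m div l"
  have n: "n > 1" using card_V by (simp add: n_def)
  have "r * l \<le> m" by (simp add: r_def)
  have "l > 0" by (simp add: l_def)
  have m_less: "m < r * l + l"
    using dividend_less_div_times[OF \<open>l > 0\<close>, of m] by (simp add: r_def add.commute)
  obtain \<mu> where \<mu>: "\<And>x. x \<in> V \<Longrightarrow> \<mu> x < m \<and> w (\<mu> x) = x"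
    and spread: "\<And>j. j < r \<Longrightarrow> \<exists>x\<in>V. j * l \<le> \<mu> x \<and> \<mu> x < j * l + l"
    using spread_marks[OF R l_def \<open>r * l \<le> m\<close>] by blast
  define D where "D = \<mu> ` V"
  have spread_D: "\<exists>q\<in>D. j * l \<le> q \<and> q < j * l + l" if "j < r" for j
    using spread[OF that] by (auto simp: D_def)
  have "inj_on \<mu> V" using \<mu> by (metis inj_onI)
  then have D: "finite D" "card D = n" using fin(1) by (auto simp: D_def n_def card_image)
  have wD: "bij_betw w D V"
    unfolding D_def using \<mu> by (intro bij_betw_byWitness[where f' = \<mu>]) auto
  obtain d where d: "bij_betw d {..<n} D" and mono: "strict_mono_on {..<n} d"
    using ex_bij_betw_strict_mono_card[OF D(1)] D(2) by metis
  have dm: "d i < m" if "i < n" for i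
  proof -
    have "d i \<in> \<mu> ` V" using bij_betwE[OF d] that by (simp add: D_def)
    then show ?thesis using \<mu> by auto
  qed
  have d_less: "d i < d j" if "i < j" "j < n" for i j
    using mono that by (auto simp: strict_mono_on_def)
  \<comment> \<open>The additional value \<open>e n\<close> is the first mark one period later,
    which closes the cyclic order.\<close>
  define e where "e i = (if i < n then d i else d 0 + m)" for i
  have e_less: "e i < e j" if "i < j" "j \<le> n" for i j
    using that d_less dm[of i] n by (auto simp: e_def)
  then have e_le: "e i \<le> e j" if "i \<le> j" "j \<le> n" for i j
    using that by (metis le_less order_refl)
  have e0: "e 0 = d 0" "e n = d 0 + m" using n by (auto simp: e_def)
  have in_D: "\<exists>k<n. q = d k" if "q \<in> D" for q
    using bij_betw_imp_surj_on[OF d] that by auto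
  \<comment> \<open>Let \<open>j\<close> be the interval after the one containing
    \<open>e i\<close>. If it is full, it holds a mark less than \<open>2 * l\<close> beyond
    \<open>e i\<close>. Otherwise less than \<open>2 * l\<close> positions remain up to
    \<open>m\<close>, and the first mark of the next round follows within another
    \<open>l\<close>.\<close>
  have gap: "e (Suc i) \<le> e i + 3 * l" if i: "i < n" for i
  proof -
    define j where "j = e i div l + 1"
    have ei: "e i = d i" using i by (simp add: e_def)
    have "e i < j * l"
      using dividend_less_div_times[OF \<open>l > 0\<close>, of "e i"] by (simp add: j_def)
    have jl: "j * l \<le> e i + l" by (simp add: j_def)
    show ?thesis
    proof (cases "j < r")
      case True
      then obtain q where q: "q \<in> D" "j * l \<le> q" "q < j * l + l"
        using spread_D by blast
      obtain k where k: "k < n" "q = d k" using in_D q(1) by blast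
      have "d i < d k" using q(2) k \<open>e i < j * l\<close> ei by simp
      then have "i < k" using d_less[of k i] i by (metis not_less_iff_gr_or_eq order_less_asym)
      then have "e (Suc i) \<le> e k" using k(1) by (intro e_le) auto
      then show ?thesis using q(3) k jl by (simp add: e_def)
    next
      case False
      then have "r * l \<le> j * l" by (intro mult_le_mono1) simp
      then have "m < e i + 2 * l" using m_less jl by linarith
      moreover have "d 0 < l"
      proof (cases "r = 0")
        case True
        then show ?thesis using m_less dm[of 0] n by simp
      next
        case False
        then obtain q where "q \<in> D" "q < l" using spread_D[of 0] by auto
        then obtain k where "k < n" "d k < l" using in_D by blast
        then show ?thesis using d_less[of 0 k] by (cases "k = 0") auto
      qed
      moreover have "e (Suc i) \<le> e n" using i by (intro e_le) auto
      ultimately show ?thesis using e0(2) by simp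
    qed
  qed
  \<comment> \<open>The marks up to index \<open>i\<close> recur one period later and the other
    marks lie beyond the piece. So all vertices are visited between \<open>b\<close> and
    \<open>a + m\<close>, as \<open>no_repetition\<close> requires.\<close>
  have distinct: "w a \<noteq> w b" if i: "i < n" and ab: "e i \<le> a" "a < b" "b \<le> e (Suc i)" for i a b
  proof (rule no_repetition[OF ab(2)])
    have ei: "e i = d i" using i by (simp add: e_def)
    have "b \<le> e n" using ab(3) e_le[of "Suc i" n] i by simp
    moreover have "d 0 \<le> a" using e_le[of 0 i] i ab(1) e0(1) by simp
    ultimately show "b \<le> a + m" using e0(2) by simp
    show "V \<subseteq> w ` {b..a + m}"
    proof
      fix x assume "x \<in> V"
      then obtain k where k: "k < n" "w (d k) = x"
        using \<mu> in_D unfolding D_def by (metis imageI)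
      show "x \<in> w ` {b..a + m}"
      proof (cases "k \<le> i")
        case True
        have "d k \<le> a" using e_le[OF True] i k(1) ab(1) by (simp add: e_def)
        moreover have "d 0 \<le> d k" using e_le[of 0 k] k(1) n by (simp add: e_def)
        then have "b \<le> d k + m" using \<open>b \<le> e n\<close> e0(2) by simp
        ultimately show ?thesis using k(2) period[of "d k"] by (intro image_eqI[of _ _ "d k + m"]) auto
      next
        case False
        then have "e (Suc i) \<le> d k" using e_le[of "Suc i" k] k(1) by (simp add: e_def)
        then show ?thesis using k ab(3) dm[OF k(1)] by (intro image_eqI[of _ _ "d k"]) auto
      qed
    qed
  qed
  define v where "v i = w (d i)" for i
  define P where "P i = map w [e i..<Suc (e (Suc i))]" for i
  have arcs_P: "path_arcs (P i) = arc ` {e i..<e (Suc i)}" for i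
    unfolding P_def path_arcs_map_upt by (simp add: arc_def)
  have we: "w (e (Suc i)) = v (Suc i mod n)" if "i < n" for i
    using that period[of "d 0"] by (cases "Suc i = n") (auto simp: e_def v_def)
  have inj: "inj_on arc {e 0..<e n}" using arc_inj[of "e n" "e 0"] e0 by simp
  have sub: "{e i..<e (Suc i)} \<subseteq> {e 0..<e n}" if "i < n" for i
    using e_le[of 0 i] e_le[of "Suc i" n] that by auto
  have dist_P: "distinct (P i)" if "i < n" for i
  proof -
    have "inj_on w {e i..<Suc (e (Suc i))}"
    proof (rule linorder_inj_onI)
      fix a b assume "a < b" "a \<in> {e i..<Suc (e (Suc i))}" "b \<in> {e i..<Suc (e (Suc i))}"
      then show "w a \<noteq> w b" using distinct[OF that, of a b] by simp
    qed auto
    then show ?thesis unfolding P_def by (simp add: distinct_map del: upt_Suc)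
  qed
  have "bij_betw v {..<n} V"
    using bij_betw_trans[OF d wD] by (simp add: v_def[abs_def] comp_def)
  moreover have "is_dipath A (P i) (v i) (v (Suc i mod n))" if i: "i < n" for i
  proof -
    have "e i < e (Suc i)" using e_less[of i "Suc i"] i by simp
    then have "hd (P i) = w (e i)" "last (P i) = w (e (Suc i))" "P i \<noteq> []"
      by (auto simp: P_def hd_map last_map simp del: upt_Suc)
    moreover have "path_arcs (P i) \<subseteq> A" using arc_in arcs_P by auto
    ultimately show ?thesis using dist_P[OF i] we[OF i] i
      unfolding is_dipath_def by (simp add: e_def v_def)
  qed
  moreover have "path_arcs (P i) \<inter> path_arcs (P j) = {}" if ij: "i < n" "j < n" "i \<noteq> j" for i j
  proof -
    have "e (Suc i) \<le> e j \<or> e (Suc j) \<le> e i" using ij e_le[of "Suc i" j] e_le[of "Suc j" i] by linarith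
    then have "{e i..<e (Suc i)} \<inter> {e j..<e (Suc j)} = {}" by auto
    then show ?thesis
      unfolding arcs_P using inj_on_image_Int[OF inj sub sub, OF ij(1,2)] by (simp only: image_empty)
  qed
  moreover have "(\<Union>i<n. path_arcs (P i)) = A"
  proof -
    have "(\<Union>i<k. {e i..<e (Suc i)}) = {e 0..<e k}" if "k \<le> n" for k
      using that
    proof (induction k)
      case (Suc k)
      then have "(\<Union>i<Suc k. {e i..<e (Suc i)}) = {e 0..<e k} \<union> {e k..<e (Suc k)}"
        by (auto simp: lessThan_Suc)
      also have "\<dots> = {e 0..<e (Suc k)}"
        using e_le[of 0 k] e_le[of k "Suc k"] Suc.prems by (intro ivl_disj_un_two(3)) auto
      finally show ?case .
    qed simp
    from this[of n] have "(\<Union>i<n. path_arcs (P i)) = arc ` {e 0..<e n}"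
      unfolding arcs_P by (metis image_UN order_refl)
    then show ?thesis using arc_window e0 by simp
  qed
  moreover have "path_length (P i) \<le> 3 * l \<and> path_length (P i) \<le> n - 1" if i: "i < n" for i
  proof
    have "path_length (P i) = e (Suc i) - e i"
      by (simp add: path_length_def P_def del: upt_Suc)
    then show "path_length (P i) \<le> 3 * l" using gap[OF i] by linarith
    have "length (P i) = card (set (P i))" using dist_P[OF i] by (simp add: distinct_card)
    also have "\<dots> \<le> n"
      unfolding n_def using w_in by (intro card_mono[OF fin(1)]) (auto simp: P_def)
    finally show "path_length (P i) \<le> n - 1" by (simp add: path_length_def)
  qed
  ultimately show ?thesis unfolding n_def l_def by blast
qed

end

subsection \<open>Numerical estimates\<close>

text \<open>For \<open>k = log 2 x\<close> the claim is the square of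
  \<open>2 powr (k / 4 + 1 / 2) \<le> k\<close>. In this range it lifts the target bound on path
  lengths to at least \<open>n\<close>.\<close>

lemma two_sqrt_le_log2_sq:
  fixes x :: real
  assumes "4 \<le> x" and "x \<le> 4096"
  shows "2 * sqrt x \<le> (log 2 x)\<^sup>2"
proof -
  define k where "k = log 2 x"
  have k: "2 \<le> k" "k \<le> 12"
    using assms by (auto simp: k_def le_log_iff log_le_iff)
  \<comment> \<open>The convex function \<open>2 powr (k / 4 + 1 / 2)\<close> lies below the identity at 2 and at 12.\<close>
  define t where "t = (k - 2) / 10"
  have t: "0 \<le> t" "t \<le> 1" using k by (auto simp: t_def)
  have "k / 4 + 1 / 2 = (1 - t) + 7 / 2 * t" by (simp add: t_def field_simps)
  then have "2 powr (k / 4 + 1 / 2) = exp ((1 - t) *\<^sub>R ln 2 + t *\<^sub>R (7 / 2 * ln 2))"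
    by (simp add: powr_def algebra_simps)
  also have "\<dots> \<le> (1 - t) * exp (ln 2) + t * exp (7 / 2 * ln 2)"
    using convex_onD[OF exp_convex, of t "ln 2" "7 / 2 * ln 2"] t by simp
  also have "exp (7 / 2 * ln 2) \<le> (12 :: real)"
  proof (rule power2_le_imp_le)
    have "(exp (7 / 2 * ln 2))\<^sup>2 = exp (real 7 * ln 2)" by (simp flip: exp_double)
    also have "\<dots> = (2 :: real) ^ 7" unfolding exp_of_nat_mult by simp
    finally show "(exp (7 / 2 * ln 2))\<^sup>2 \<le> (12 :: real)\<^sup>2" by simp
  qed simp
  then have "(1 - t) * exp (ln 2) + t * exp (7 / 2 * ln 2) \<le> (1 - t) * 2 + t * 12"
    using t by (intro add_mono mult_left_mono) auto
  also have "\<dots> = k" by (simp add: t_def field_simps)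
  finally have "(2 powr (k / 4 + 1 / 2))\<^sup>2 \<le> k\<^sup>2" by (intro power_mono) auto
  moreover have "(2 powr (k / 4 + 1 / 2))\<^sup>2 = 2 powr (1 + k * (1 / 2))"
    unfolding power2_eq_square powr_add[symmetric] by (rule arg_cong[where f = "(powr) 2"]) simp
  then have "(2 powr (k / 4 + 1 / 2))\<^sup>2 = 2 * 2 powr (k * (1 / 2))" by (simp add: powr_add)
  moreover have "2 powr (k * (1 / 2)) = sqrt x"
    unfolding powr_powr[symmetric] using assms by (simp add: k_def powr_half_sqrt)
  ultimately show ?thesis by (simp add: k_def)
qed

text \<open>Up to 4096 the trivial bound \<open>n - 1\<close> suffices, with rounding up needed for
  2 and 3; beyond that the bound of order \<open>sqrt n\<close> takes over.\<close>

lemma length_le_half_log2_sq: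
  assumes "n > 1" and "real N \<le> 27 * sqrt (real n) + 30" and "N \<le> n - 1"
  shows "real N \<le> of_int \<lceil>1/2 * (log 2 (real n))\<^sup>2 * sqrt (real n)\<rceil>" (is "_ \<le> of_int \<lceil>?x\<rceil>")
proof -
  consider "n = 2" | "n = 3" | "4 \<le> n" "n \<le> 4096" | "4096 < n" using assms(1) by linarith
  then show ?thesis
  proof cases
    case 1
    then have "0 < ?x" by simp
    then have "1 \<le> \<lceil>?x\<rceil>" by linarith
    then show ?thesis using assms(3) 1 by linarith
  next
    case 2
    \<comment> \<open>This gives \<open>?x \<ge> 9 / 8\<close>, so its ceiling is at least
      2.\<close>
    have "3 / 2 \<le> log 2 (3 :: real)"
    proof -
      have "2 powr (3 / 2 :: real) \<le> 3"
      proof (rule power2_le_imp_le)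
        have "(2 powr (3 / 2 :: real))\<^sup>2 = 2 powr 3" by (simp add: power2_eq_square flip: powr_add)
        then show "(2 powr (3 / 2 :: real))\<^sup>2 \<le> 3\<^sup>2" by simp
      qed simp
      then show ?thesis by (subst le_log_iff) auto
    qed
    then have "(3 / 2)\<^sup>2 \<le> (log 2 (3 :: real))\<^sup>2" by (intro power_mono) auto
    moreover have "1 \<le> sqrt (3 :: real)" by simp
    ultimately have "1/2 * (3 / 2)\<^sup>2 * 1 \<le> 1/2 * (log 2 (3 :: real))\<^sup>2 * sqrt 3"
      by (intro mult_mono) auto
    then have "2 \<le> \<lceil>?x\<rceil>" using 2 by (simp add: power2_eq_square)
    then show ?thesis using assms(3) 2 by linarith
  next
    case 3
    then have "2 * sqrt (real n) \<le> (log 2 (real n))\<^sup>2" by (intro two_sqrt_le_log2_sq) auto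
    then have "sqrt (real n) * sqrt (real n) \<le> ?x"
      by (intro mult_right_mono) auto
    then have "real n \<le> ?x" by simp
    then show ?thesis using assms(3) by linarith
  next
    case 4
    \<comment> \<open>4096 is \<open>2 ^ 12\<close>, and half of \<open>12\<^sup>2\<close> is 72,
      more than 27 + 30.\<close>
    then have "12 \<le> log 2 (real n)" by (simp add: le_log_iff)
    then have "12\<^sup>2 \<le> (log 2 (real n))\<^sup>2" by (intro power_mono) auto
    then have "72 * sqrt (real n) \<le> ?x" by (intro mult_right_mono) auto
    moreover have "1 \<le> sqrt (real n)" using assms(1) by simp
    ultimately show ?thesis using assms(2) by linarith
  qed
qed

section \<open>The factor in the length bound\<close>

text \<open>The constant 100 makes the second argument dominate the bound \<open>27 \<surd>n + 30\<close> for all \<open>n > 1\<close>.\<close>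
definition length_factor :: "nat \<Rightarrow> real" where
  "length_factor n = min (1/2 * (log 2 (real n))\<^sup>2) (100 * log 2 (real n) powr log (3/2) 2)"

text \<open>The exponent \<open>log (3/2) 2\<close> is below 2, so the second argument of the
  minimum is eventually the smaller one. Its constant 100 is \<open>log 2 n\<close> raised to
  \<open>ln 100 / ln (log 2 n)\<close>, an exponent that tends to 0.\<close>

lemma length_factor_asymptotics:
  "\<exists>g. (g \<longlongrightarrow> 0) at_top \<and>
    (\<forall>\<^sub>F n in at_top. length_factor n = log 2 (real n) powr (log (3/2) 2 + g n))"
proof (intro exI conjI)
  let ?k = "\<lambda>n. log 2 (real n)"
  let ?g = "\<lambda>n. ln 100 / ln (?k n)"
  show "(?g \<longlongrightarrow> 0) at_top" by real_asymp
  \<comment> \<open>Positive because 2 < (3/2)^2 = 9/4.\<close>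
  define c where "c = 2 - log (3/2) (2 :: real)"
  have "c > 0" by (simp add: c_def log_less_iff power2_eq_square)
  then have "filterlim (\<lambda>n. ?k n powr c) at_top at_top" by real_asymp
  \<comment> \<open>200 is the quotient of the constants 100 and 1/2 in the two arguments of the
    minimum.\<close>
  then have "\<forall>\<^sub>F n in at_top. 200 \<le> ?k n powr c" by (simp add: filterlim_at_top)
  moreover have "\<forall>\<^sub>F n in at_top. 1 < ?k n" by real_asymp
  ultimately show "\<forall>\<^sub>F n in at_top. length_factor n = ?k n powr (log (3/2) 2 + ?g n)"
  proof eventually_elim
    case (elim n)
    have "?k n powr ?g n = 100" using elim(2) by (simp add: powr_def)
    moreover have "200 * ?k n powr log (3/2) 2 \<le> ?k n powr c * ?k n powr log (3/2) 2"
      using elim(1) by (rule mult_right_mono) simp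
    moreover have "?k n powr c * ?k n powr log (3/2) 2 = (?k n)\<^sup>2"
      using elim(2) by (simp add: c_def flip: powr_add)
    ultimately show ?case by (simp add: length_factor_def powr_add)
  qed
qed

text \<open>When the minimum is its second argument, the factor is at least 100, since
  \<open>log 2 n \<ge> 1\<close>; this exceeds 27 + 30.\<close>

lemma length_le_length_factor:
  assumes "n > 1" and "real N \<le> 27 * sqrt (real n) + 30" and "N \<le> n - 1"
  shows "real N \<le> of_int \<lceil>length_factor n * sqrt (real n)\<rceil>"
proof (cases "1/2 * (log 2 (real n))\<^sup>2 \<le> 100 * log 2 (real n) powr log (3/2) 2")
  case True
  then have "length_factor n = 1/2 * (log 2 (real n))\<^sup>2" by (simp add: length_factor_def)
  then show ?thesis using length_le_half_log2_sq[OF assms] by (simp only:)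
next
  case False
  have "1 \<le> log 2 (real n)" using assms(1) by (simp add: le_log_iff)
  moreover have "0 \<le> log (3/2) (2 :: real)" by simp
  ultimately have "1 \<le> log 2 (real n) powr log (3/2) 2" by (rule ge_one_powr_ge_zero)
  then have "100 \<le> length_factor n" using False by (simp add: length_factor_def)
  then have "100 * sqrt (real n) \<le> length_factor n * sqrt (real n)" by (intro mult_right_mono) auto
  moreover have "1 \<le> sqrt (real n)" using assms(1) by simp
  ultimately show ?thesis using assms(2) by linarith
qed

section \<open>Combination of the path decomposition with the estimates\<close>

theorem theorem2p1:
  shows "\<exists>f :: nat \<Rightarrow> real.
    (\<exists>g :: nat \<Rightarrow> real. (g \<longlongrightarrow> 0) at_top \<and>
        (\<forall>\<^sub>F n in at_top. f n = (log 2 (real n)) powr (log (3/2) 2 + g n))) \<and>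
    (\<forall>n>1. f n \<le> (1/2) * (log 2 (real n))^2) \<and>
    (\<forall>(V :: 'a set) A. minimally_eulerian V A \<and> card V > 1 \<longrightarrow>
       (\<exists>(v :: nat \<Rightarrow> 'a) (P :: nat \<Rightarrow> 'a list).
          bij_betw v {..<card V} V \<and>
          (\<forall>i<card V. is_dipath A (P i) (v i) (v (Suc i mod card V))) \<and>
          (\<forall>i<card V. \<forall>j<card V. i \<noteq> j \<longrightarrow> path_arcs (P i) \<inter> path_arcs (P j) = {}) \<and>
          (\<Union>i<card V. path_arcs (P i)) = A \<and>
          (\<forall>i<card V. real (path_length (P i))
                \<le> of_int \<lceil>f (card V) * sqrt (real (card V))\<rceil>) \<and>
          (\<forall>i<card V. real (path_length (P i))
                \<le> of_int \<lceil>(1/2) * sqrt (real (card V)) * (log 2 (real (card V)))^2\<rceil>)))"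
proof (rule exI[of _ length_factor], intro conjI allI impI)
  show "\<exists>g. (g \<longlongrightarrow> 0) at_top \<and>
      (\<forall>\<^sub>F n in at_top. length_factor n = log 2 (real n) powr (log (3/2) 2 + g n))"
    by (rule length_factor_asymptotics)
  show "length_factor n \<le> 1/2 * (log 2 (real n))^2" for n by (simp add: length_factor_def)
  fix V :: "'a set" and A
  assume "minimally_eulerian V A \<and> card V > 1"
  then have min: "minimally_eulerian V A" and n: "card V > 1" by auto
  have "A \<noteq> {}"
  proof
    assume "A = {}"
    then have "\<forall>x\<in>V. \<forall>y\<in>V. x = y"
      using min by (simp add: minimally_eulerian_def eulerian_def digraph_connected_def)
    then have "card V \<le> 1"
      using n by (metis One_nat_def card.infinite card_le_Suc0_iff_eq le0)
    then show False using n by simp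
  qed
  moreover have "simple_digraph V A" "eulerian V A" using min by (auto simp: minimally_eulerian_def)
  ultimately obtain w m where "m > 0" "bij_betw (\<lambda>p. (w p, w (Suc p))) {..<m} A"
    "\<And>p. w (p + m) = w p"
    using euler_tour by metis
  then interpret minimal_tour V A w m using min n by unfold_locales
  \<comment> \<open>The least \<open>R\<close> with \<open>card V \<le> R\<^sup>2\<close>. As it is
    at most \<open>sqrt n + 1\<close>, the bound \<open>3 * (9 * R + 1)\<close> becomes
    \<open>27 * sqrt n + 30\<close>.\<close>
  define R where "R = nat \<lceil>sqrt (real (card V))\<rceil>"
  have "sqrt (real (card V)) \<le> real R" unfolding R_def by (rule of_nat_ceiling)
  then have "(sqrt (real (card V)))\<^sup>2 \<le> (real R)\<^sup>2" by (intro power_mono) auto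
  then have "real (card V) \<le> real (R\<^sup>2)" by simp
  then have R: "card V \<le> R\<^sup>2" by (simp only: of_nat_le_iff)
  have "real R \<le> sqrt (real (card V)) + 1" by (simp add: R_def)
  have bound: "real N \<le> 27 * sqrt (real (card V)) + 30" if "N \<le> 3 * (9 * R + 1)" for N
  proof -
    have "real N \<le> 27 * real R + 3" using that by (simp flip: of_nat_le_iff[where ?'a = real])
    then show ?thesis using \<open>real R \<le> sqrt (real (card V)) + 1\<close> by linarith
  qed
  obtain v P where P: "bij_betw v {..<card V} V"
    "\<forall>i<card V. is_dipath A (P i) (v i) (v (Suc i mod card V))"
    "\<forall>i<card V. \<forall>j<card V. i \<noteq> j \<longrightarrow> path_arcs (P i) \<inter> path_arcs (P j) = {}"
    "(\<Union>i<card V. path_arcs (P i)) = A"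
    and len: "\<And>i. i < card V \<Longrightarrow> path_length (P i) \<le> 3 * (9 * R + 1)"
      "\<And>i. i < card V \<Longrightarrow> path_length (P i) \<le> card V - 1"
    using path_decomposition[OF R] by blast
  have len1: "real (path_length (P i)) \<le> of_int \<lceil>length_factor (card V) * sqrt (real (card V))\<rceil>"
    if "i < card V" for i
    by (rule length_le_length_factor[OF n bound[OF len(1)[OF that]] len(2)[OF that]])
  have len2: "real (path_length (P i))
      \<le> of_int \<lceil>1/2 * sqrt (real (card V)) * (log 2 (real (card V)))^2\<rceil>"
    if "i < card V" for i
    using length_le_half_log2_sq[OF n bound[OF len(1)[OF that]] len(2)[OF that]]
    by (simp only: mult.assoc mult.commute[of "sqrt _"])
  show "\<exists>v P. bij_betw v {..<card V} V \<and>
      (\<forall>i<card V. is_dipath A (P i) (v i) (v (Suc i mod card V))) \<and>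
      (\<forall>i<card V. \<forall>j<card V. i \<noteq> j \<longrightarrow> path_arcs (P i) \<inter> path_arcs (P j) = {}) \<and>
      (\<Union>i<card V. path_arcs (P i)) = A \<and>
      (\<forall>i<card V. real (path_length (P i))
          \<le> of_int \<lceil>length_factor (card V) * sqrt (real (card V))\<rceil>) \<and>
      (\<forall>i<card V. real (path_length (P i))
          \<le> of_int \<lceil>(1/2) * sqrt (real (card V)) * (log 2 (real (card V)))^2\<rceil>)"
    by (rule exI[of _ v], rule exI[of _ P]) (intro conjI P allI impI; (rule len1 | rule len2); assumption)
qed

end
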